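(* Let $L,G^1,\ldots,G^r\in C^1([a,b]\times\mathbb{R}^{2N};\mathbb{R})$, $\mathbf{y}^a,\mathbf{y}^b\in\mathbb{R}^N$, $l_1,\ldots,l_r\in\mathbb{R}$. Consider the isoperimetric problem of minimizing $\mathcal{J}(\mathbf{y})=\int_a^bL[\mathbf{y}]^{\alpha,\beta}_{\gamma}(x)\,dx$ over all $\mathbf{y}\in\mathbf{D}$ satisfying $\mathbf{y}(a)=\mathbf{y}^a$, $\mathbf{y}(b)=\mathbf{y}^b$ and $$\int_a^bG^j[\mathbf{y}]^{\alpha,\beta}_{\gamma}(x)\,dx=l_j,\quad j=1,\ldots,r.$$ Suppose that for some constants $\bar\lambda_1,\ldots,\bar\lambda_r\in\mathbb{R}$ the function $F(x,\mathbf{y},\mathbf{v})=L(x,\mathbf{y},\mathbf{v})-\sum_{j=1}^r\bar\lambda_jG^j(x,\mathbf{y},\mathbf{v})$ is jointly convex in $(\mathbf{y},\mathbf{v})$. If $\mathbf{y}^0\in\mathbf{D}$ satisfies the boundary conditions $\mathbf{y}^0(a)=\mathbf{y}^a$, $\mathbf{y}^0(b)=\mathbf{y}^b$, the isoperimetric constraints $\int_a^bG^j[\mathbf{y}^0]^{\alpha,\beta}_{\gamma}(x)\,dx=l_j$, $j=1,\ldots,r$, and the system of $N$ fractional Euler--Lagrange equations $$\partial_iF[\mathbf{y}^0]^{\alpha,\beta}_{\gamma}(x)+D^{\beta_{i-1},\alpha_{i-1}}_{1-\gamma_{i-1}}\,\partial_{N+i}F[\mathbf{y}^0]^{\alpha,\beta}_{\gamma}(x)=0,\qquad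 x\in[a,b],\quad i=2,\ldots,N+1,$$ then $\mathbf{y}^0$ is a minimizer of the isoperimetric problem, i.e. $\mathcal{J}(\mathbf{y}^0)\le\mathcal{J}(\mathbf{y})$ for every $\mathbf{y}\in\mathbf{D}$ satisfying $\mathbf{y}(a)=\mathbf{y}^a$, $\mathbf{y}(b)=\mathbf{y}^b$ and $\int_a^bG^j[\mathbf{y}]^{\alpha,\beta}_{\gamma}(x)\,dx=l_j$, $j=1,\ldots,r$.
   Context: Let $a<b$, $N,r\in\mathbb{N}$, and $\alpha,\beta,\gamma\in\mathbb{R}^N$ with $\alpha_i,\beta_i\in(0,1)$, $\gamma_i\in[0,1]$. For scalar $\alpha\in(0,1)$, the left and right Riemann--Liouville fractional integrals are ${}_aI_x^{\alpha}f(x)=\frac{1}{\Gamma(\alpha)}\int_a^x(x-t)^{\alpha-1}f(t)\,dt$ and ${}_xI_b^{\alpha}f(x)=\frac{1}{\Gamma(\alpha)}\int_x^b(t-x)^{\alpha-1}f(t)\,dt$. The left and right Riemann--Liouville derivatives are ${}_aD_x^{\alpha}f=\frac{d}{dx}\,{}_aI_x^{1-\alpha}f$ and ${}_xD_b^{\alpha}f=-\frac{d}{dx}\,{}_xI_b^{1-\alpha}f$. For $f\in AC([a,b])$ (absolutely continuous), the left and right Caputo derivatives are ${}^C_aD_x^{\alpha}f={}_aI_x^{1-\alpha}f'$ and ${}^C_xD_b^{\alpha}f=-\,{}_xI_b^{1-\alpha}f'$. For scalars $\alpha,\beta\in(0,1)$, $\gamma\in[0,1]$: the combined Caputo derivative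 is ${}^CD^{\alpha,\beta}_{\gamma}=\gamma\,{}^C_aD_x^{\alpha}+(1-\gamma)\,{}^C_xD_b^{\beta}$, and $D^{\beta,\alpha}_{1-\gamma}=(1-\gamma)\,{}_aD_x^{\beta}+\gamma\,{}_xD_b^{\alpha}$. For vector parameters and $\mathbf{y}=(y_1,\ldots,y_N)$, ${}^CD^{\alpha,\beta}_{\gamma}\mathbf{y}=[{}^CD^{\alpha_1,\beta_1}_{\gamma_1}y_1,\ldots,{}^CD^{\alpha_N,\beta_N}_{\gamma_N}y_N]$. $\mathbf{D}$ is the set of $\mathbf{y}:[a,b]\to\mathbb{R}^N$ with components in $AC([a,b])$ such that ${}^CD^{\alpha,\beta}_{\gamma}\mathbf{y}$ exists and is continuous on $[a,b]$. $[\mathbf{y}]^{\alpha,\beta}_{\gamma}(x)=(x,\mathbf{y}(x),{}^CD^{\alpha,\beta}_{\gamma}\mathbf{y}(x))$, and $K[\mathbf{y}]^{\alpha,\beta}_{\gamma}(x)$ is $K$ evaluated at this point. $\partial_iK$ is the partial derivative of $K$ with respect to its $i$th argument (for $i=2,\ldots,N+1$, $\partial_iK$ is with respect to the $(i-1)$th component of $\mathbf{y}$ and $\partial_{N+i}K$ with respect to the $(i-1)$th component of $\mathbf{v}$). A function $f\in C^1([a,b]\times\mathbb{R}^{2N};\mathbb{R})$ is jointly convex in $(\mathbf{y},\mathbf{v})$ if $$f(x,\mathbf{y}+\mathbf{y}^0,\mathbf{v}+\mathbf{v}^0)-f(x,\mathbf{y},\mathbf{v})\ge\sum_{i=2}^{N+1}\partial_if(x,\mathbf{y},\mathbf{v})\,y^0_{i-1}+\sum_{i=2}^{N+1}\partial_{N+i}f(x,\mathbf{y},\mathbf{v})\,v^0_{i-1}$$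 for all $(x,\mathbf{y},\mathbf{v}),(x,\mathbf{y}+\mathbf{y}^0,\mathbf{v}+\mathbf{v}^0)\in[a,b]\times\mathbb{R}^{2N}$. *)

theory Defs
  imports "HOL-Analysis.Analysis"
begin

definition AC_on :: "real \<Rightarrow> real \<Rightarrow> (real \<Rightarrow> real) \<Rightarrow> bool" where
  "AC_on a b f \<longleftrightarrow>
     (\<forall>\<epsilon>>0. \<exists>\<delta>>0. \<forall>I :: (real \<times> real) set.
        finite I \<and> (\<forall>(u, v)\<in>I. a \<le> u \<and> u \<le> v \<and> v \<le> b) \<and>
        disjoint_family_on (\<lambda>(u, v). {u<..<v}) I \<and> (\<Sum>(u, v)\<in>I. v - u) < \<delta>
        \<longrightarrow> (\<Sum>(u, v)\<in>I. \<bar>f v - f u\<bar>) < \<epsilon>)"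

(* Fractional integrals are Lebesgue integrals, evaluated at every point.  The total functions
   below return junk where the integral does not exist, so existence is tracked by separate
   predicates.  The value 0 powr (\<alpha> - 1) = 0 on the diagonal only concerns a null set. *)

definition RL_int_left_exists :: "real \<Rightarrow> real \<Rightarrow> (real \<Rightarrow> real) \<Rightarrow> real \<Rightarrow> bool" where
  "RL_int_left_exists a \<alpha> f x \<longleftrightarrow>
     set_integrable lebesgue {a..x} (\<lambda>t. (x - t) powr (\<alpha> - 1) * f t)"

definition RL_int_left :: "real \<Rightarrow> real \<Rightarrow> (real \<Rightarrow> real) \<Rightarrow> real \<Rightarrow> real" where
  "RL_int_left a \<alpha> f x =
     1 / Gamma \<alpha> * (LINT t:{a..x}|lebesgue. (x - t) powr (\<alpha> - 1) * f t)"

definition RL_int_right_exists :: "real \<Rightarrow> real \<Rightarrow> (real \<Rightarrow> real) \<Rightarrow> real \<Rightarrow> bool" where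
  "RL_int_right_exists b \<alpha> f x \<longleftrightarrow>
     set_integrable lebesgue {x..b} (\<lambda>t. (t - x) powr (\<alpha> - 1) * f t)"

definition RL_int_right :: "real \<Rightarrow> real \<Rightarrow> (real \<Rightarrow> real) \<Rightarrow> real \<Rightarrow> real" where
  "RL_int_right b \<alpha> f x =
     1 / Gamma \<alpha> * (LINT t:{x..b}|lebesgue. (t - x) powr (\<alpha> - 1) * f t)"

(* At the end points of [a,b] the derivative d/dx is one-sided. *)

definition RL_deriv_left_exists :: "real \<Rightarrow> real \<Rightarrow> real \<Rightarrow> (real \<Rightarrow> real) \<Rightarrow> real \<Rightarrow> bool" where
  "RL_deriv_left_exists a b \<alpha> f x \<longleftrightarrow>
     (\<forall>s\<in>{a..b}. RL_int_left_exists a (1 - \<alpha>) f s) \<and>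
     RL_int_left a (1 - \<alpha>) f differentiable (at x within {a..b})"

definition RL_deriv_left :: "real \<Rightarrow> real \<Rightarrow> real \<Rightarrow> (real \<Rightarrow> real) \<Rightarrow> real \<Rightarrow> real" where
  "RL_deriv_left a b \<alpha> f x =
     vector_derivative (RL_int_left a (1 - \<alpha>) f) (at x within {a..b})"

definition RL_deriv_right_exists :: "real \<Rightarrow> real \<Rightarrow> real \<Rightarrow> (real \<Rightarrow> real) \<Rightarrow> real \<Rightarrow> bool" where
  "RL_deriv_right_exists a b \<alpha> f x \<longleftrightarrow>
     (\<forall>s\<in>{a..b}. RL_int_right_exists b (1 - \<alpha>) f s) \<and>
     RL_int_right b (1 - \<alpha>) f differentiable (at x within {a..b})"

definition RL_deriv_right :: "real \<Rightarrow> real \<Rightarrow> real \<Rightarrow> (real \<Rightarrow> real) \<Rightarrow> real \<Rightarrow> real" where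
  "RL_deriv_right a b \<alpha> f x =
     - vector_derivative (RL_int_right b (1 - \<alpha>) f) (at x within {a..b})"

(* Caputo derivatives are meant for f absolutely continuous on [a,b]; then f' exists almost
   everywhere there, and the values of deriv f on the exceptional null set, which includes the
   end points, are irrelevant under the integral. *)

definition Caputo_left_exists :: "real \<Rightarrow> real \<Rightarrow> (real \<Rightarrow> real) \<Rightarrow> real \<Rightarrow> bool" where
  "Caputo_left_exists a \<alpha> f x \<longleftrightarrow> RL_int_left_exists a (1 - \<alpha>) (deriv f) x"

definition Caputo_left :: "real \<Rightarrow> real \<Rightarrow> (real \<Rightarrow> real) \<Rightarrow> real \<Rightarrow> real" where
  "Caputo_left a \<alpha> f x = RL_int_left a (1 - \<alpha>) (deriv f) x"

definition Caputo_right_exists :: "real \<Rightarrow> real \<Rightarrow> (real \<Rightarrow> real) \<Rightarrow> real \<Rightarrow> bool" where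
  "Caputo_right_exists b \<alpha> f x \<longleftrightarrow> RL_int_right_exists b (1 - \<alpha>) (deriv f) x"

definition Caputo_right :: "real \<Rightarrow> real \<Rightarrow> (real \<Rightarrow> real) \<Rightarrow> real \<Rightarrow> real" where
  "Caputo_right b \<alpha> f x = - RL_int_right b (1 - \<alpha>) (deriv f) x"

(* In the combined operators a summand with coefficient 0 is regarded as absent, so that for
   \<gamma> = 1 and \<gamma> = 0 they are exactly the one-sided operators. *)

definition combined_Caputo_exists ::
    "real \<Rightarrow> real \<Rightarrow> real \<Rightarrow> real \<Rightarrow> real \<Rightarrow> (real \<Rightarrow> real) \<Rightarrow> real \<Rightarrow> bool" where
  "combined_Caputo_exists a b \<alpha> \<beta> \<gamma> f x \<longleftrightarrow>
     (\<gamma> \<noteq> 0 \<longrightarrow> Caputo_left_exists a \<alpha> f x) \<and> (\<gamma> \<noteq> 1 \<longrightarrow> Caputo_right_exists b \<beta> f x)"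

definition combined_Caputo ::
    "real \<Rightarrow> real \<Rightarrow> real \<Rightarrow> real \<Rightarrow> real \<Rightarrow> (real \<Rightarrow> real) \<Rightarrow> real \<Rightarrow> real" where
  "combined_Caputo a b \<alpha> \<beta> \<gamma> f x = \<gamma> * Caputo_left a \<alpha> f x + (1 - \<gamma>) * Caputo_right b \<beta> f x"

(* combined_RL a b \<mu> \<nu> \<eta> is the operator D^{\<mu>,\<nu>}_\<eta>: left order \<mu> with weight \<eta>, right order \<nu> with
   weight 1 - \<eta>.  The dual D^{\<beta>,\<alpha>}_{1-\<gamma>} of the combined Caputo derivative is
   combined_RL a b \<beta> \<alpha> (1 - \<gamma>). *)

definition combined_RL_exists ::
    "real \<Rightarrow> real \<Rightarrow> real \<Rightarrow> real \<Rightarrow> real \<Rightarrow> (real \<Rightarrow> real) \<Rightarrow> real \<Rightarrow> bool" where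
  "combined_RL_exists a b \<mu> \<nu> \<eta> f x \<longleftrightarrow>
     (\<eta> \<noteq> 0 \<longrightarrow> RL_deriv_left_exists a b \<mu> f x) \<and> (\<eta> \<noteq> 1 \<longrightarrow> RL_deriv_right_exists a b \<nu> f x)"

definition combined_RL ::
    "real \<Rightarrow> real \<Rightarrow> real \<Rightarrow> real \<Rightarrow> real \<Rightarrow> (real \<Rightarrow> real) \<Rightarrow> real \<Rightarrow> real" where
  "combined_RL a b \<mu> \<nu> \<eta> f x = \<eta> * RL_deriv_left a b \<mu> f x + (1 - \<eta>) * RL_deriv_right a b \<nu> f x"

definition vec_Caputo ::
    "real \<Rightarrow> real \<Rightarrow> real ^ 'n \<Rightarrow> real ^ 'n \<Rightarrow> real ^ 'n \<Rightarrow> (real \<Rightarrow> real ^ 'n) \<Rightarrow> real \<Rightarrow> real ^ 'n" where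
  "vec_Caputo a b \<alpha> \<beta> \<gamma> y x =
     (\<chi> i. combined_Caputo a b (\<alpha> $ i) (\<beta> $ i) (\<gamma> $ i) (\<lambda>t. y t $ i) x)"

(* The set bold D.  Members are functions on all of the reals, but only their restrictions to
   [a,b] matter. *)

definition Caputo_space ::
    "real \<Rightarrow> real \<Rightarrow> real ^ 'n \<Rightarrow> real ^ 'n \<Rightarrow> real ^ 'n \<Rightarrow> (real \<Rightarrow> real ^ 'n) set" where
  "Caputo_space a b \<alpha> \<beta> \<gamma> =
     {y. (\<forall>i. AC_on a b (\<lambda>t. y t $ i)) \<and>
         (\<forall>x\<in>{a..b}. \<forall>i. combined_Caputo_exists a b (\<alpha> $ i) (\<beta> $ i) (\<gamma> $ i) (\<lambda>t. y t $ i) x) \<and>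
         continuous_on {a..b} (vec_Caputo a b \<alpha> \<beta> \<gamma> y)}"

definition bracket ::
    "real \<Rightarrow> real \<Rightarrow> real ^ 'n \<Rightarrow> real ^ 'n \<Rightarrow> real ^ 'n \<Rightarrow> (real \<Rightarrow> real ^ 'n) \<Rightarrow> real
      \<Rightarrow> real \<times> (real ^ 'n) \<times> (real ^ 'n)" where
  "bracket a b \<alpha> \<beta> \<gamma> y x = (x, y x, vec_Caputo a b \<alpha> \<beta> \<gamma> y x)"

definition C1_on :: "'a::real_normed_vector set \<Rightarrow> ('a \<Rightarrow> real) \<Rightarrow> bool" where
  "C1_on S f \<longleftrightarrow>
     (\<exists>f' :: 'a \<Rightarrow> 'a \<Rightarrow>\<^sub>L real.
        (\<forall>p\<in>S. (f has_derivative blinfun_apply (f' p)) (at p within S)) \<and> continuous_on S f')"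

definition partial_y ::
    "'n \<Rightarrow> (real \<times> (real ^ 'n) \<times> (real ^ 'n) \<Rightarrow> real) \<Rightarrow> real \<times> (real ^ 'n) \<times> (real ^ 'n) \<Rightarrow> real" where
  "partial_y i K = (\<lambda>(x, y, v). deriv (\<lambda>s. K (x, (\<chi> k. if k = i then s else y $ k), v)) (y $ i))"

definition partial_v ::
    "'n \<Rightarrow> (real \<times> (real ^ 'n) \<times> (real ^ 'n) \<Rightarrow> real) \<Rightarrow> real \<times> (real ^ 'n) \<times> (real ^ 'n) \<Rightarrow> real" where
  "partial_v i K = (\<lambda>(x, y, v). deriv (\<lambda>s. K (x, y, (\<chi> k. if k = i then s else v $ k))) (v $ i))"

definition jointly_convex ::
    "real \<Rightarrow> real \<Rightarrow> (real \<times> (real ^ 'n) \<times> (real ^ 'n) \<Rightarrow> real) \<Rightarrow> bool" where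
  "jointly_convex a b f \<longleftrightarrow>
     C1_on ({a..b} \<times> UNIV) f \<and>
     (\<forall>x\<in>{a..b}. \<forall>y v y0 v0.
        f (x, y + y0, v + v0) - f (x, y, v) \<ge>
          (\<Sum>i\<in>UNIV. partial_y i f (x, y, v) * y0 $ i) +
          (\<Sum>i\<in>UNIV. partial_v i f (x, y, v) * v0 $ i))"

end

(* An absolutely continuous f is differentiable almost everywhere: where difference quotients <= s and
   >= t > s both occur at arbitrarily small scales, Vitali coverings by intervals of either kind, nested
   in each other, leave gaps of small total length carrying a large increment.  Since f maps families
   of intervals of small total length to small variation, a gauge that traps the exceptional null set
   in a small open set gives the fundamental theorem of calculus and integration by parts for f.

   By Fubini, the left fractional integral is dual to the right one.  Hence for f in D and g with
   combined derivatives the integral of g times the Caputo derivative of f equals the integral of f' H,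
   where H = gamma I_right g - (1 - gamma) I_left g.  The Euler-Lagrange equation says that H is C^1 with
   derivative partial_y F, so integrating by parts makes the first variation of F at y0 vanish in every
   admissible direction, and convexity with the multipliers turns this into minimality. *)

theory Submission
  imports Defs
begin

text \<open>A Caputo derivative is an integral of \<open>deriv f\<close>, a total function with
  arbitrary values where f has no derivative. Absolute continuity therefore has to give two things:
  \<open>deriv f\<close> is the derivative almost everywhere, and it integrates back to f. Fubini
  needs \<open>deriv f\<close> to be Lebesgue integrable. This is read off from a one-sided Caputo
  derivative at an end point, where the fractional integral runs over all of [a,b]. For g =
  partial_v F along y0, the one-sided Riemann-Liouville derivatives are only known to exist
  pointwise, and neither of them need be continuous. Their combination is, because the
  Euler-Lagrange equation equates it with -partial_y F. So H is Lipschitz, f H is absolutely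
  continuous, and ordinary integration by parts is available although g itself has no regularity
  beyond continuity. The identity is proved for y and y0 separately and then subtracted, since
  \<open>deriv\<close> is additive only where both derivatives exist.\<close>

section \<open>Increments of absolutely continuous functions over divisions\<close>

text \<open>Intervals of a division have disjoint interiors, so the pairs (Inf K, Sup K) form a
  family to which \<open>AC_on\<close> applies. This form suits Vitali coverings and gauge-fine
  divisions, both of which deliver divisions.\<close>

lemma AC_on_division:
  assumes "AC_on a b f" and "0 < e"
  obtains d where "0 < d"
    "\<And>p. p division_of \<Union>p \<Longrightarrow> \<Union>p \<subseteq> {a..b} \<Longrightarrow> (\<Sum>K\<in>p. measure lebesgue K) < d \<Longrightarrow>
      (\<Sum>K\<in>p. \<bar>f (Sup K) - f (Inf K)\<bar>) < e"
proof -
  from assms obtain d where "d > 0" and d: "\<And>I :: (real \<times> real) set.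
        finite I \<Longrightarrow> (\<forall>(u, v)\<in>I. a \<le> u \<and> u \<le> v \<and> v \<le> b) \<Longrightarrow>
        disjoint_family_on (\<lambda>(u, v). {u<..<v}) I \<Longrightarrow> (\<Sum>(u, v)\<in>I. v - u) < d \<Longrightarrow>
        (\<Sum>(u, v)\<in>I. \<bar>f v - f u\<bar>) < e"
    unfolding AC_on_def by meson
  show thesis
  proof (rule that[OF \<open>d > 0\<close>])
    fix p :: "real set set"
    assume p: "p division_of \<Union>p" and sub: "\<Union>p \<subseteq> {a..b}" and sum: "(\<Sum>K\<in>p. measure lebesgue K) < d"
    note D = division_ofD[OF p]
    let ?g = "\<lambda>K :: real set. (Inf K, Sup K)"
    have K: "K = {Inf K..Sup K} \<and> Inf K \<le> Sup K" if "K \<in> p" for K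
    proof -
      obtain u v where "K = cbox u v" "K \<noteq> {}" using D(3,4) \<open>K \<in> p\<close> by blast
      then show ?thesis by auto
    qed
    have inj: "inj_on ?g p"
      by (rule inj_onI) (metis K Pair_inject)
    have "(\<Sum>(u, v)\<in>?g ` p. \<bar>f v - f u\<bar>) < e"
    proof (rule d)
      show "finite (?g ` p)" using D(1) by auto
      show "\<forall>(u, v)\<in>?g ` p. a \<le> u \<and> u \<le> v \<and> v \<le> b"
      proof clarsimp
        fix K assume "K \<in> p"
        moreover have "K \<subseteq> {a..b}" using \<open>K \<in> p\<close> sub by blast
        ultimately show "a \<le> Inf K \<and> Inf K \<le> Sup K \<and> Sup K \<le> b"
          using K[OF \<open>K \<in> p\<close>] by (metis atLeastatMost_subset_iff order.order_iff_strict)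
      qed
      show "disjoint_family_on (\<lambda>(u, v). {u<..<v}) (?g ` p)"
        unfolding disjoint_family_on_def
      proof (intro ballI impI)
        fix i j assume "i \<in> ?g ` p" "j \<in> ?g ` p" "i \<noteq> j"
        then obtain L M where LM: "L \<in> p" "M \<in> p" "L \<noteq> M" "i = ?g L" "j = ?g M" by blast
        then have "interior L \<inter> interior M = {}" using D(5) by auto
        moreover have "interior L = {Inf L<..<Sup L}" "interior M = {Inf M<..<Sup M}"
          using K[OF LM(1)] K[OF LM(2)] interior_atLeastAtMost_real by metis+
        ultimately show "(\<lambda>(u, v). {u<..<v}) i \<inter> (\<lambda>(u, v). {u<..<v}) j = {}"
          using LM by simp
      qed
      have "(\<Sum>(u, v)\<in>?g ` p. v - u) = (\<Sum>K\<in>p. measure lebesgue K)"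
      proof -
        have "measure lebesgue L = Sup L - Inf L" if "L \<in> p" for L
        proof -
          have "measure lebesgue {Inf L..Sup L} = Sup L - Inf L"
            using K[OF that, THEN conjunct2] by simp
          then show ?thesis using K[OF that] by metis
        qed
        then show ?thesis by (simp add: sum.reindex[OF inj])
      qed
      then show "(\<Sum>(u, v)\<in>?g ` p. v - u) < d" using sum by simp
    qed
    then show "(\<Sum>K\<in>p. \<bar>f (Sup K) - f (Inf K)\<bar>) < e"
      by (simp add: sum.reindex[OF inj])
  qed
qed

text \<open>Tagging every interval with its left end point gives a tagged division, whose increments
  telescope.\<close>

lemma sum_increments_division:
  fixes f :: "real \<Rightarrow> real"
  assumes "p division_of {a..b}" and "a \<le> b"
  shows "(\<Sum>K\<in>p. f (Sup K) - f (Inf K)) = f b - f a"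
proof -
  note D = division_ofD[OF assms(1)]
  let ?t = "\<lambda>K :: real set. (Inf K, K)"
  have "?t ` p tagged_division_of {a..b}"
  proof (rule tagged_division_ofI)
    show "finite (?t ` p)" using D(1) by simp
    fix x K assume "(x, K) \<in> ?t ` p"
    then have K: "K \<in> p" "x = Inf K" by auto
    then obtain u v where "K = cbox u v" "K \<noteq> {}" using D(3,4) by blast
    then show "x \<in> K" "\<exists>a b. K = cbox a b" using K by auto
    show "K \<subseteq> {a..b}" using D(2) K by auto
  next
    fix x1 K1 x2 K2
    assume "(x1, K1) \<in> ?t ` p" "(x2, K2) \<in> ?t ` p" "(x1, K1) \<noteq> (x2, K2)"
    then show "interior K1 \<inter> interior K2 = {}"
      by (intro D(5)) auto
  next
    have "{K. \<exists>x. (x, K) \<in> ?t ` p} = p" by auto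
    then show "\<Union> {K. \<exists>x. (x, K) \<in> ?t ` p} = {a..b}" using D(6) by simp
  qed
  from additive_tagged_division_1[OF assms(2) this, of f] show ?thesis
    by (subst (asm) sum.reindex) (auto simp: inj_on_def)
qed

text \<open>The same remainder completes both divisions to divisions of [a,b], where all increments
  add up to f b - f a. This allows two unrelated divisions of one union of intervals to be
  compared.\<close>

lemma sum_increments_division_eq:
  fixes f :: "real \<Rightarrow> real"
  assumes p: "p division_of S" and q: "q division_of S" and "S \<subseteq> {a..b}" and ab: "a \<le> b"
  shows "(\<Sum>K\<in>p. f (Sup K) - f (Inf K)) = (\<Sum>K\<in>q. f (Sup K) - f (Inf K))"
proof -
  have S: "S = \<Union>p" using division_ofD(6)[OF p] by simp
  obtain P where P: "p \<subseteq> P" "P division_of {a..b}"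
    using partial_division_extend_interval[of p a b] p S assms(3) by auto
  note D = division_ofD[OF P(2)]
  let ?R = "P - p"
  have R: "?R division_of \<Union>?R" by (rule division_of_subset[OF division_of_union_self[OF P(2)]]) auto
  have box: "\<exists>u v. K = cbox u v" if "K \<in> P" for K using D(4) that by simp
  have fin: "finite ?R" "finite p" using D(1) P(1) finite_subset by auto
  have "interior T \<inter> interior (\<Union>p) = {}" if "T \<in> ?R" for T
  proof (rule Int_interior_Union_intervals)
    show "interior T \<inter> interior K = {}" if "K \<in> p" for K
      using D(5)[of T K] P(1) that \<open>T \<in> ?R\<close> by blast
  qed (use fin box P(1) in auto)
  then have "interior S \<inter> interior T = {}" if "T \<in> ?R" for T using that S by blast
  then have disj: "interior S \<inter> interior (\<Union>?R) = {}"
    by (intro Int_interior_Union_intervals) (use fin box in auto)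
  have eq: "(\<Sum>K\<in>s. f (Sup K) - f (Inf K)) = f b - f a - (\<Sum>K\<in>?R. f (Sup K) - f (Inf K))"
    if s: "s division_of S" for s
  proof -
    have "\<Union>P = {a..b}" using D(6) .
    moreover have "S \<union> \<Union>?R = \<Union>P" using S P(1) by blast
    ultimately have "S \<union> \<Union>?R = {a..b}" by simp
    then have div: "s \<union> ?R division_of {a..b}" using division_disjoint_union[OF s R disj] by simp
    \<comment> \<open>The division \<open>s\<close> and the remainder can share only one-point
      intervals, over which the increment is 0.\<close>
    have "f (Sup K) - f (Inf K) = 0" if K: "K \<in> s \<inter> ?R" for K
    proof -
      have "interior K = {}"
        using K disj division_ofD(2)[OF s] interior_mono[of K S] interior_mono[of K "\<Union>?R"] by blast
      moreover obtain u v where "K = cbox u v" "K \<noteq> {}" using K division_ofD(3,4)[OF s] by blast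
      ultimately show ?thesis by auto
    qed
    then have "(\<Sum>K\<in>s \<union> ?R. f (Sup K) - f (Inf K)) =
        (\<Sum>K\<in>s. f (Sup K) - f (Inf K)) + (\<Sum>K\<in>?R. f (Sup K) - f (Inf K))"
      using fin division_ofD(1)[OF s] by (intro sum.union_inter_neutral) auto
    with sum_increments_division[OF div ab, of f] show ?thesis by simp
  qed
  show ?thesis using eq[OF p] eq[OF q] by simp
qed

section \<open>Vitali coverings and exceptional slopes\<close>

text \<open>An interval is the ball around its midpoint, so the Vitali theorem for balls gives
  countably many disjoint admissible intervals inside U that cover E up to a null set. Finitely many
  of them carry all but e of the total length. As E may fail to be measurable, its size is expressed
  through a measurable superset T.\<close>

lemma Vitali_covering_intervals:
  fixes E U :: "real set"
  assumes EU: "E \<subseteq> U" and U: "open U" "U \<in> lmeasurable" and "0 < e"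
    and cover: "\<And>x d. x \<in> E \<Longrightarrow> 0 < d \<Longrightarrow> \<exists>u v. u \<le> x \<and> x \<le> v \<and> u < v \<and> v - u < d \<and> P u v"
  obtains p T where "p division_of \<Union>p" "\<Union>p \<subseteq> U"
    "\<forall>K\<in>p. Inf K < Sup K \<and> P (Inf K) (Sup K)"
    "T \<in> lmeasurable" "E \<subseteq> T" "measure lebesgue T < measure lebesgue (\<Union>p) + e"
proof -
  define I where "I = {(u, v). u < v \<and> P u v \<and> {u..v} \<subseteq> U}"
  let ?c = "\<lambda>(u, v). (u + v) / 2 :: real" and ?r = "\<lambda>(u, v). (v - u) / 2 :: real"
  let ?K = "\<lambda>(u, v). {u..v} :: real set"
  have cb: "cball (?c i) (?r i) = ?K i" for i
    by (cases i) (auto simp: cball_eq_atLeastAtMost field_simps)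
  obtain C where C: "countable C" "C \<subseteq> I"
     "pairwise (\<lambda>i j. disjnt (cball (?c i) (?r i)) (cball (?c j) (?r j))) C"
     "negligible (E - (\<Union>i \<in> C. cball (?c i) (?r i)))"
  proof (rule Vitali_covering_theorem_cballs)
    show "0 < ?r i" if "i \<in> I" for i using that by (auto simp: I_def)
    fix x d :: real assume "x \<in> E" "0 < d"
    then obtain d' where d': "d' > 0" "ball x d' \<subseteq> U"
      using EU U(1) by (meson open_contains_ball subsetD)
    obtain u v where uv: "u \<le> x" "x \<le> v" "u < v" "v - u < min d d'" "P u v"
      using cover[of x "min d d'"] \<open>x \<in> E\<close> \<open>0 < d\<close> d'(1) by auto
    have "{u..v} \<subseteq> ball x d'"
      using uv by (auto simp: dist_real_def)
    then have "(u, v) \<in> I" using uv d' by (auto simp: I_def)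
    then show "\<exists>i. i \<in> I \<and> x \<in> cball (?c i) (?r i) \<and> ?r i < d"
      by (rule_tac x="(u, v)" in exI, unfold cb) (use uv in auto)
  qed
  note C = C[unfolded cb]
  have sub: "\<Union>(?K ` C) \<subseteq> U" using C(2) by (auto simp: I_def)
  have KU: "k \<subseteq> U" "k \<in> lmeasurable" if "k \<in> ?K ` C" for k
    using that C(2) by (auto simp: I_def)
  have bound: "measure lebesgue (\<Union>D') \<le> measure lebesgue U" if "D' \<subseteq> ?K ` C" "finite D'" for D'
  proof (rule measure_mono_fmeasurable)
    show "\<Union>D' \<subseteq> U" using that KU by blast
    show "\<Union>D' \<in> sets lebesgue"
      using that KU by (intro sets.finite_Union) (auto simp: fmeasurable_def)
  qed (rule U)
  have Cm: "\<Union>(?K ` C) \<in> lmeasurable"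
    by (rule fmeasurable_Union_bound[OF _ _ bound]) (use C(1) KU in auto)
  obtain D' where D': "D' \<subseteq> ?K ` C" "finite D'"
    "measure lebesgue (\<Union>(?K ` C)) - e < measure lebesgue (\<Union>D')"
    by (rule measure_countable_Union_approachable[OF _ \<open>0 < e\<close> KU(2) bound]) (use C(1) in auto)
  show thesis
  proof (rule that)
    show "D' division_of \<Union>D'"
    proof (rule division_ofI)
      show "finite D'" by fact
      fix k assume "k \<in> D'"
      then obtain i where i: "i \<in> C" "k = ?K i" using D'(1) by auto
      then have "i \<in> I" using C(2) by auto
      then show "k \<noteq> {}" "\<exists>a b. k = cbox a b" using i by (auto simp: I_def)
      show "k \<subseteq> \<Union>D'" using \<open>k \<in> D'\<close> by auto
      fix k' assume "k' \<in> D'" "k \<noteq> k'"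
      then obtain j where j: "j \<in> C" "k' = ?K j" using D'(1) by blast
      have "i \<noteq> j" using i j \<open>k \<noteq> k'\<close> by auto
      then have "k \<inter> k' = {}" using C(3) i j by (auto simp: pairwise_def disjnt_def)
      then show "interior k \<inter> interior k' = {}" using interior_subset by blast
    qed auto
    show "\<Union>D' \<subseteq> U" using D'(1) KU by blast
    show "\<forall>k\<in>D'. Inf k < Sup k \<and> P (Inf k) (Sup k)"
      using D'(1) C(2) by (fastforce simp: I_def)
    let ?T = "\<Union>(?K ` C) \<union> (E - \<Union>(?K ` C))"
    show "?T \<in> lmeasurable"
      using Cm negligible_imp_measurable[OF C(4)] by (rule fmeasurable.Un)
    show "E \<subseteq> ?T" by auto
    have "measure lebesgue ?T = measure lebesgue (\<Union>(?K ` C))"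
      using C(4) Cm by (intro measure_Un_null_set) (auto simp: negligible_iff_null_sets fmeasurableD)
    then show "measure lebesgue ?T < measure lebesgue (\<Union>D') + e" using D'(3) by simp
  qed
qed

text \<open>If E had outer measure m > 0, flat intervals p and, inside them, steep intervals q would
  both have total length close to m. The increment over the gaps is that over p minus that over q,
  roughly at most (s - t) m, whereas absolute continuity makes it small.\<close>

lemma AC_on_crossing_slopes_negligible:
  assumes f: "AC_on a b f" and "E \<subseteq> {a<..<b}" and "s < t"
    and low: "\<And>x d. x \<in> E \<Longrightarrow> 0 < d \<Longrightarrow>
      \<exists>u v. u \<le> x \<and> x \<le> v \<and> u < v \<and> v - u < d \<and> f v - f u \<le> s * (v - u)"
    and high: "\<And>x d. x \<in> E \<Longrightarrow> 0 < d \<Longrightarrow>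
      \<exists>u v. u \<le> x \<and> x \<le> v \<and> u < v \<and> v - u < d \<and> t * (v - u) \<le> f v - f u"
  shows "negligible E"
proof (rule ccontr)
  assume "\<not> negligible E"
  let ?\<mu> = "measure lebesgue"
  let ?\<Delta> = "\<lambda>K. f (Sup K) - f (Inf K)"
  let ?M = "{?\<mu> T | T. T \<in> lmeasurable \<and> E \<subseteq> T}"
  \<comment> \<open>The outer measure of E. It is positive, since a set of outer measure 0 is
    negligible.\<close>
  define m where "m = Inf ?M"
  have bdd: "bdd_below ?M" by (rule bdd_belowI[of _ 0]) auto
  have "{a<..<b} \<in> lmeasurable" by (simp add: lmeasurable_interval)
  then have ne: "?M \<noteq> {}" using assms(2) by blast
  have m_le: "m \<le> ?\<mu> T" if "T \<in> lmeasurable" "E \<subseteq> T" for T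
    unfolding m_def by (rule cInf_lower[OF _ bdd]) (use that in auto)
  have m_less: "\<exists>T. E \<subseteq> T \<and> T \<in> lmeasurable \<and> ?\<mu> T < e" if "m < e" for e
    using that cInf_less_iff[OF ne bdd, of e] unfolding m_def by blast
  have "0 < m"
  proof (rule ccontr)
    assume "\<not> 0 < m"
    then have "m < e" if "0 < e" for e using that by simp
    then have "negligible E" unfolding negligible_outer using m_less by presburger
    then show False using \<open>\<not> negligible E\<close> by contradiction
  qed
  have "a \<le> b" using assms(2) \<open>\<not> negligible E\<close> by (cases "E = {}") auto
  \<comment> \<open>Chosen so that the final balance reads: the increment over the gaps is at most
    \<epsilon> - 3 \<epsilon>, yet its modulus is below \<epsilon>.\<close>
  define \<epsilon> where "\<epsilon> = (t - s) * m / 4"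
  have "\<epsilon> > 0" using \<open>s < t\<close> \<open>0 < m\<close> by (simp add: \<epsilon>_def)
  obtain \<delta> where "\<delta> > 0" and \<delta>: "\<And>p. p division_of \<Union>p \<Longrightarrow> \<Union>p \<subseteq> {a..b} \<Longrightarrow>
      (\<Sum>K\<in>p. ?\<mu> K) < \<delta> \<Longrightarrow> (\<Sum>K\<in>p. \<bar>?\<Delta> K\<bar>) < \<epsilon>"
    by (rule AC_on_division[OF f \<open>\<epsilon> > 0\<close>]) blast
  \<comment> \<open>The unions of p and q will measure less than m + d and more than m - 3 d, so the
    gaps measure less than 4 d. The three bounds on d make absolute continuity apply to the gaps,
    make q measure at least 3 m / 4, and keep the error s times the gap length below
    \<epsilon>.\<close>
  define d where "d = min (\<delta> / 5) (min (m / 12) (\<epsilon> / (4 * (\<bar>s\<bar> + 1))))"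
  have d: "0 < d" "4 * d < \<delta>" "12 * d \<le> m" and sd: "4 * \<bar>s\<bar> * d \<le> \<epsilon>"
  proof -
    show "0 < d" "4 * d < \<delta>" "12 * d \<le> m"
      using \<open>\<delta> > 0\<close> \<open>0 < m\<close> \<open>\<epsilon> > 0\<close> by (auto simp: d_def min_less_iff_disj)
    have "4 * \<bar>s\<bar> * d \<le> 4 * (\<bar>s\<bar> + 1) * d" using \<open>0 < d\<close> by (simp add: mult_right_mono)
    also have "\<dots> \<le> 4 * (\<bar>s\<bar> + 1) * (\<epsilon> / (4 * (\<bar>s\<bar> + 1)))"
      by (intro mult_left_mono) (auto simp: d_def)
    also have "\<dots> = \<epsilon>" by simp
    finally show "4 * \<bar>s\<bar> * d \<le> \<epsilon>" .
  qed
  have "m < m + d / 2" using \<open>0 < d\<close> by simp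
  then obtain T0 where T0: "T0 \<in> lmeasurable" "E \<subseteq> T0" "?\<mu> T0 < m + d / 2"
    using m_less[of "m + d / 2"] by blast
  obtain U0 where U0: "open U0" "T0 \<subseteq> U0" "U0 - T0 \<in> lmeasurable" "emeasure lebesgue (U0 - T0) < ennreal (d / 2)"
    using sets_lebesgue_outer_open[of T0 "d/2"] T0(1) \<open>0 < d\<close> by (auto simp: fmeasurable_def)
  define U where "U = U0 \<inter> {a<..<b}"
  have U: "open U" "E \<subseteq> U" "U \<subseteq> {a..b}" using U0 T0 assms(2) by (auto simp: U_def)
  have Um: "U \<in> lmeasurable" using \<open>open U\<close> \<open>U \<subseteq> {a..b}\<close>
    by (meson bounded_closed_interval bounded_subset lmeasurable_open)
  have U_less: "?\<mu> U < m + d"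
  proof -
    have "U0 - T0 \<union> T0 \<in> lmeasurable" using U0(3) T0(1) by (rule fmeasurable.Un)
    then have "?\<mu> U \<le> ?\<mu> (U0 - T0 \<union> T0)"
      by (intro measure_mono_fmeasurable) (use Um in \<open>auto simp: U_def fmeasurableD\<close>)
    also have "\<dots> \<le> ?\<mu> (U0 - T0) + ?\<mu> T0"
      using U0(3) T0(1) by (intro measure_Un_le) (auto simp: fmeasurableD)
    also have "?\<mu> (U0 - T0) < d / 2"
      using U0(3,4) \<open>0 < d\<close> by (simp add: emeasure_eq_measure2 ennreal_less_iff)
    finally show ?thesis using T0(3) by simp
  qed
  obtain p T1 where p: "p division_of \<Union>p" "\<Union>p \<subseteq> U"
    and p_low: "\<forall>K\<in>p. Inf K < Sup K \<and> ?\<Delta> K \<le> s * (Sup K - Inf K)"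
    and T1: "T1 \<in> lmeasurable" "E \<subseteq> T1" "?\<mu> T1 < ?\<mu> (\<Union>p) + d"
    by (rule Vitali_covering_intervals[OF U(2) U(1) Um \<open>0 < d\<close> low]) (assumption | rule that)+
  have p_gt: "m - d < ?\<mu> (\<Union>p)" using m_le[OF T1(1,2)] T1(3) by simp
  have pm: "\<Union>p \<in> lmeasurable" using p(1) by (rule lmeasurable_division)
  have p_lt: "?\<mu> (\<Union>p) < m + d"
    using measure_mono_fmeasurable[OF p(2) _ Um] pm U_less by (auto simp: fmeasurableD)
  \<comment> \<open>The second covering has to live in an open set. Passing to the interior loses
    only finitely many end points.\<close>
  let ?V = "interior (\<Union>p)"
  have fr: "negligible (\<Union>p - ?V)"
  proof -
    have "\<Union>p - ?V \<subseteq> (\<Union>K\<in>p. {Inf K, Sup K})"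
    proof (rule subsetI, rule ccontr)
      fix x assume "x \<in> \<Union>p - ?V" and nx: "x \<notin> (\<Union>K\<in>p. {Inf K, Sup K})"
      then obtain K where x: "K \<in> p" "x \<in> K" "x \<notin> ?V" by blast
      obtain u v where "K = {u..v}" "u \<le> v"
        using division_ofD(3,4)[OF p(1) x(1)] by (metis atLeastatMost_empty_iff box_real(2))
      then have "x \<in> interior K" using x(1,2) nx by fastforce
      then show False using x(1,3) interior_mono[of K "\<Union>p"] by blast
    qed
    moreover have "finite (\<Union>K\<in>p. {Inf K, Sup K})" using division_ofD(1)[OF p(1)] by auto
    ultimately show ?thesis by (meson negligible_finite negligible_subset)
  qed
  have Vm: "?V \<in> lmeasurable" 
    using elementary_bounded[OF p(1)] by (simp add: bounded_interior lmeasurable_open)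
  obtain q T2 where q: "q division_of \<Union>q" "\<Union>q \<subseteq> ?V"
    and q_high: "\<forall>K\<in>q. Inf K < Sup K \<and> t * (Sup K - Inf K) \<le> ?\<Delta> K"
    and T2: "T2 \<in> lmeasurable" "E \<inter> ?V \<subseteq> T2" "?\<mu> T2 < ?\<mu> (\<Union>q) + d"
    by (rule Vitali_covering_intervals[OF Int_lower2 open_interior Vm \<open>0 < d\<close> high[OF IntD1]]) (assumption | rule that)+
  have qm: "\<Union>q \<in> lmeasurable" using q(1) by (rule lmeasurable_division)
  have qp: "\<Union>q \<subseteq> \<Union>p" using q(2) interior_subset by blast
  \<comment> \<open>E is covered by \<open>T2\<close>, the part of U outside p, and a null set. The
    first measures less than d beyond q, the second less than (m + d) - (m - d).\<close>
  have q_gt: "m - 3 * d < ?\<mu> (\<Union>q)"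
  proof -
    let ?N = "\<Union>p - ?V"
    have lm: "T2 \<union> (U - \<Union>p) \<in> lmeasurable" "U - \<Union>p \<in> lmeasurable" "?N \<in> lmeasurable"
      using T2(1) Um pm fr by (auto intro: fmeasurable.Un fmeasurable.Diff negligible_imp_measurable)
    have "E \<subseteq> T2 \<union> (U - \<Union>p) \<union> ?N" using T2(2) U(2) by blast
    then have "m \<le> ?\<mu> (T2 \<union> (U - \<Union>p) \<union> ?N)" by (rule m_le[rotated]) (use lm in \<open>auto intro: fmeasurable.Un\<close>)
    also have "\<dots> = ?\<mu> (T2 \<union> (U - \<Union>p))"
      using lm fr by (intro measure_Un_null_set) (auto simp: negligible_iff_null_sets fmeasurableD)
    also have "\<dots> \<le> ?\<mu> T2 + ?\<mu> (U - \<Union>p)" using T2(1) lm by (intro measure_Un_le) (auto simp: fmeasurableD)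
    also have "?\<mu> (U - \<Union>p) = ?\<mu> U - ?\<mu> (\<Union>p)" by (rule measurable_measure_Diff[OF Um _ p(2)]) (use pm in \<open>simp add: fmeasurableD\<close>)
    finally show ?thesis using T2(3) U_less p_gt by simp
  qed
  \<comment> \<open>The intervals of \<open>r\<close> outside \<open>q\<close> are the gaps that q
    leaves in p.\<close>
  obtain r where r: "q \<subseteq> r" "r division_of \<Union>p"
    using partial_division_extend[OF q(1) p(1) qp] by blast
  have fin: "finite r" "finite q" using division_ofD(1) r q(1) by auto
  have g: "r - q division_of \<Union>(r - q)"
    by (rule division_of_subset[OF division_of_union_self[OF r(2)]]) auto
  have gsub: "\<Union>(r - q) \<subseteq> {a..b}" using division_ofD(6)[OF r(2)] p(2) U(3) by blast
  have ab: "\<Union>p \<subseteq> {a..b}" using p(2) U(3) by blast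
  have len: "?\<mu> K = Sup K - Inf K" if K: "K \<in> k" "k division_of S" for K k S
  proof -
    obtain u v where "K = cbox u v" "K \<noteq> {}" using division_ofD(3,4)[OF K(2,1)] by blast
    then show ?thesis by simp
  qed
  have cp: "(\<Sum>K\<in>p. Sup K - Inf K) = ?\<mu> (\<Union>p)"
    using content_division[OF p(1)] len[OF _ p(1)] by simp
  have cq: "(\<Sum>K\<in>q. Sup K - Inf K) = ?\<mu> (\<Union>q)"
    using content_division[OF q(1)] len[OF _ q(1)] by simp
  have "(\<Sum>K\<in>r - q. ?\<mu> K) = ?\<mu> (\<Union>p) - ?\<mu> (\<Union>q)"
    using content_division[OF q(1)] content_division[OF r(2)] by (simp add: sum_diff fin r(1))
  then have "(\<Sum>K\<in>r - q. ?\<mu> K) < \<delta>" using p_lt q_gt d by simp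
  from \<delta>[OF g gsub this] have gap: "(\<Sum>K\<in>r - q. \<bar>?\<Delta> K\<bar>) < \<epsilon>" .
  have "(\<Sum>K\<in>r - q. ?\<Delta> K) = (\<Sum>K\<in>p. ?\<Delta> K) - (\<Sum>K\<in>q. ?\<Delta> K)"
    using sum_increments_division_eq[OF r(2) p(1) ab \<open>a \<le> b\<close>, of f] by (simp only: sum_diff fin r(1))
  moreover have "(\<Sum>K\<in>p. ?\<Delta> K) \<le> s * ?\<mu> (\<Union>p)"
    unfolding cp[symmetric] sum_distrib_left by (intro sum_mono) (use p_low in blast)
  moreover have "(\<Sum>K\<in>q. ?\<Delta> K) \<ge> t * ?\<mu> (\<Union>q)"
    unfolding cq[symmetric] sum_distrib_left by (intro sum_mono) (use q_high in blast)
  ultimately have "(\<Sum>K\<in>r - q. ?\<Delta> K) \<le> s * (?\<mu> (\<Union>p) - ?\<mu> (\<Union>q)) - (t - s) * ?\<mu> (\<Union>q)"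
    by (simp add: algebra_simps)
  moreover have "s * (?\<mu> (\<Union>p) - ?\<mu> (\<Union>q)) \<le> \<epsilon>"
  proof -
    have "0 \<le> ?\<mu> (\<Union>p) - ?\<mu> (\<Union>q)"
      using measure_mono_fmeasurable[OF qp _ pm] qm by (auto simp: fmeasurableD)
    then have "s * (?\<mu> (\<Union>p) - ?\<mu> (\<Union>q)) \<le> \<bar>s\<bar> * (4 * d)"
      using p_lt q_gt by (intro mult_mono) auto
    then show ?thesis using sd by simp
  qed
  moreover have "(t - s) * ?\<mu> (\<Union>q) \<ge> (t - s) * (3 / 4 * m)"
    using q_gt d(3) \<open>s < t\<close> by (intro mult_left_mono) auto
  moreover have "(t - s) * (3 / 4 * m) = 3 * \<epsilon>" by (simp add: \<epsilon>_def)
  moreover have "\<bar>\<Sum>K\<in>r - q. ?\<Delta> K\<bar> < \<epsilon>" using gap sum_abs[of ?\<Delta> "r - q"] by linarith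
  ultimately show False using \<open>\<epsilon> > 0\<close> by linarith
qed

text \<open>Disjoint intervals of total length below \<delta> have variation below 1, so if their
  slopes are at least 2 / e in modulus, their total length is below e / 2. Working in a ball of
  radius \<delta> / 3, which has length 2 \<delta> / 3, enforces the bound \<delta>; negligibility
  is a local property.\<close>

lemma AC_on_infinite_slopes_negligible:
  assumes f: "AC_on a b f" and E: "E \<subseteq> {a<..<b}"
    and steep: "\<And>x d B. x \<in> E \<Longrightarrow> 0 < d \<Longrightarrow>
      \<exists>u v. u \<le> x \<and> x \<le> v \<and> u < v \<and> v - u < d \<and> B * (v - u) \<le> \<bar>f v - f u\<bar>"
  shows "negligible E"
proof -
  let ?\<mu> = "measure lebesgue"
  obtain \<delta> where "\<delta> > 0" and \<delta>: "\<And>p. p division_of \<Union>p \<Longrightarrow> \<Union>p \<subseteq> {a..b} \<Longrightarrow>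
      (\<Sum>K\<in>p. ?\<mu> K) < \<delta> \<Longrightarrow> (\<Sum>K\<in>p. \<bar>f (Sup K) - f (Inf K)\<bar>) < 1"
    by (rule AC_on_division[OF f zero_less_one]) blast
  have local: "negligible (E \<inter> ball x (\<delta> / 3))" for x
    unfolding negligible_outer
  proof (intro allI impI)
    fix e :: real assume "0 < e"
    let ?U = "{a<..<b} \<inter> ball x (\<delta> / 3)" and ?B = "2 / e"
    have Um: "?U \<in> lmeasurable" by (intro lmeasurable_open bounded_Int open_Int) auto
    have U: "open ?U" by (intro open_Int) auto
    have EU: "E \<inter> ball x (\<delta> / 3) \<subseteq> ?U" using E by blast
    have "0 < e / 2" using \<open>0 < e\<close> by simp
    obtain p T where p: "p division_of \<Union>p" "\<Union>p \<subseteq> ?U"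
      and steep_p: "\<forall>K\<in>p. Inf K < Sup K \<and> ?B * (Sup K - Inf K) \<le> \<bar>f (Sup K) - f (Inf K)\<bar>"
      and T: "T \<in> lmeasurable" "E \<inter> ball x (\<delta> / 3) \<subseteq> T" "?\<mu> T < ?\<mu> (\<Union>p) + e / 2"
      by (rule Vitali_covering_intervals[OF EU U Um \<open>0 < e / 2\<close> steep[OF IntD1]]) (assumption | rule that)+
    have len: "?\<mu> K = Sup K - Inf K" if K: "K \<in> p" for K
    proof -
      obtain u v where "K = cbox u v" "K \<noteq> {}" using division_ofD(3,4)[OF p(1) K] by blast
      then show ?thesis by simp
    qed
    have "?\<mu> (\<Union>p) \<le> ?\<mu> (ball x (\<delta> / 3))"
      using p(2) lmeasurable_division[OF p(1)]
      by (intro measure_mono_fmeasurable) (auto simp: fmeasurableD)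
    also have "\<dots> < \<delta>"
      using \<open>\<delta> > 0\<close> by (simp add: ball_eq_greaterThanLessThan)
    finally have "(\<Sum>K\<in>p. ?\<mu> K) < \<delta>" using content_division[OF p(1)] by simp
    moreover have "\<Union>p \<subseteq> {a..b}" using p(2) by fastforce
    ultimately have "(\<Sum>K\<in>p. \<bar>f (Sup K) - f (Inf K)\<bar>) < 1" using \<delta> p(1) by blast
    moreover have "?B * ?\<mu> (\<Union>p) \<le> (\<Sum>K\<in>p. \<bar>f (Sup K) - f (Inf K)\<bar>)"
      unfolding content_division[OF p(1), symmetric] sum_distrib_left
      by (intro sum_mono) (use steep_p len in simp)
    ultimately have "?B * ?\<mu> (\<Union>p) < 1" by linarith
    then have "?\<mu> (\<Union>p) < e / 2" using \<open>0 < e\<close> by (simp add: field_simps)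
    then show "\<exists>T. E \<inter> ball x (\<delta> / 3) \<subseteq> T \<and> T \<in> lmeasurable \<and> ?\<mu> T < e"
      by (intro exI[of _ T] conjI) (use T in auto)
  qed
  show ?thesis
    unfolding locally_negligible_alt[of E]
  proof
    fix x assume "x \<in> E"
    then show "\<exists>U. openin (top_of_set E) U \<and> x \<in> U \<and> negligible U"
      using local[of x] \<open>\<delta> > 0\<close>
      by (intro exI[of _ "E \<inter> ball x (\<delta> / 3)"]) auto
  qed
qed

section \<open>Differentiability almost everywhere\<close>

text \<open>A difference quotient is symmetric in its two points, so a nearby y on either side of x
  yields an interval with x as an end point. This is why the coverings above admit intervals in
  which x is not central.\<close>

lemma frequently_slope_imp_interval:
  fixes f :: "real \<Rightarrow> real"
  assumes "\<exists>\<^sub>F y in at x. P ((f y - f x) / (y - x))" and "0 < d"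
  shows "\<exists>u v. u \<le> x \<and> x \<le> v \<and> u < v \<and> v - u < d \<and> P ((f v - f u) / (v - u))"
proof -
  have "\<exists>\<^sub>F y in at x. P ((f y - f x) / (y - x)) \<and> y \<noteq> x \<and> dist y x < d"
    using assms by (intro frequently_eventually_frequently eventually_conj eventually_at_ball')
      (auto simp: eventually_at intro: exI[of _ d])
  then obtain y where y: "P ((f y - f x) / (y - x))" "y \<noteq> x" "dist y x < d"
    by (blast dest: frequently_ex)
  have "(f x - f y) / (x - y) = (f y - f x) / (y - x)"
    by (metis minus_diff_eq minus_divide_divide)
  then show ?thesis
    using y by (intro exI[of _ "min x y"] exI[of _ "max x y"]) (auto simp: min_def max_def dist_real_def)
qed

text \<open>Difference quotients that stay bounded and whose lower and upper limits agree converge.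
  Boundedness fails only on \<open>I\<close>; when it holds and the limits differ, rationals s < t
  fit between them and x lies in \<open>E s t\<close>. Restricting to rationals keeps the union
  countable.\<close>

theorem AC_on_imp_differentiable_ae:
  assumes f: "AC_on a b f"
  shows "negligible {x \<in> {a<..<b}. \<not> f differentiable (at x)}"
proof -
  let ?S = "\<lambda>x y. (f y - f x) / (y - x)"
  define E where "E s t = {x \<in> {a<..<b}. (\<exists>\<^sub>F y in at x. ?S x y < s) \<and> (\<exists>\<^sub>F y in at x. t < ?S x y)}" for s t
  define I where "I = {x \<in> {a<..<b}. \<forall>B. \<exists>\<^sub>F y in at x. B < \<bar>?S x y\<bar>}"
  have "negligible (E s t)" if "s < t" for s t
  proof (rule AC_on_crossing_slopes_negligible[OF f _ that])
    fix x d :: real assume x: "x \<in> E s t" "0 < d"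
    obtain u v where "u \<le> x" "x \<le> v" "u < v" "v - u < d" "(f v - f u) / (v - u) < s"
      using frequently_slope_imp_interval[of "\<lambda>z. z < s" f x d] x by (auto simp: E_def)
    then show "\<exists>u v. u \<le> x \<and> x \<le> v \<and> u < v \<and> v - u < d \<and> f v - f u \<le> s * (v - u)"
      by (intro exI[of _ u] exI[of _ v]) (auto simp: field_simps)
    obtain u v where "u \<le> x" "x \<le> v" "u < v" "v - u < d" "t < (f v - f u) / (v - u)"
      using frequently_slope_imp_interval[of "\<lambda>z. t < z" f x d] x by (auto simp: E_def)
    then show "\<exists>u v. u \<le> x \<and> x \<le> v \<and> u < v \<and> v - u < d \<and> t * (v - u) \<le> f v - f u"
      by (intro exI[of _ u] exI[of _ v]) (auto simp: field_simps)
  qed (auto simp: E_def)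
  then have E: "negligible (\<Union>(s, t)\<in>{(s, t). s \<in> \<rat> \<and> t \<in> \<rat> \<and> s < t}. E s t)"
    by (intro negligible_countable_Union)
      (auto intro: countable_subset[OF _ countable_SIGMA[OF countable_rat countable_rat]])
  have I: "negligible I"
  proof (rule AC_on_infinite_slopes_negligible[OF f])
    fix x d B :: real assume "x \<in> I" "0 < d"
    then obtain u v where "u \<le> x" "x \<le> v" "u < v" "v - u < d" "B < \<bar>(f v - f u) / (v - u)\<bar>"
      using frequently_slope_imp_interval[of "\<lambda>z. B < \<bar>z\<bar>" f x d] by (auto simp: I_def)
    then show "\<exists>u v. u \<le> x \<and> x \<le> v \<and> u < v \<and> v - u < d \<and> B * (v - u) \<le> \<bar>f v - f u\<bar>"
      by (intro exI[of _ u] exI[of _ v]) (auto simp: abs_divide field_simps)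
  qed (auto simp: I_def)
  show ?thesis
  proof (rule negligible_subset[OF negligible_Un[OF E I]], rule subsetI, rule ccontr)
    fix x assume "x \<in> {x \<in> {a<..<b}. \<not> f differentiable (at x)}"
      and n: "x \<notin> (\<Union>(s, t)\<in>{(s, t). s \<in> \<rat> \<and> t \<in> \<rat> \<and> s < t}. E s t) \<union> I"
    then have x: "x \<in> {a<..<b}" "\<not> f differentiable (at x)" by auto
    obtain B where B: "\<forall>\<^sub>F y in at x. \<bar>?S x y\<bar> \<le> B"
      using n x(1) by (auto simp: I_def not_frequently not_less)
    let ?e = "\<lambda>y. ereal (?S x y)"
    have "Limsup (at x) ?e \<le> Liminf (at x) ?e"
    proof (rule ccontr)
      assume "\<not> ?thesis"
      then have "Liminf (at x) ?e < Limsup (at x) ?e" by simp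
      then obtain s' where s': "Liminf (at x) ?e < ereal s'" "ereal s' < Limsup (at x) ?e"
        using ereal_dense2 by blast
      obtain t' where t': "ereal s' < ereal t'" "ereal t' < Limsup (at x) ?e"
        using ereal_dense2[OF s'(2)] by blast
      obtain s where s: "s \<in> \<rat>" "s' < s" "s < t'" using Rats_dense_in_real[of s' t'] t'(1) by auto
      obtain t where t: "t \<in> \<rat>" "s < t" "t < t'" using Rats_dense_in_real[of s t'] s by auto
      have "x \<notin> E s t" using n s t by auto
      then consider "\<forall>\<^sub>F y in at x. s \<le> ?S x y" | "\<forall>\<^sub>F y in at x. ?S x y \<le> t"
        using x(1) by (auto simp: E_def not_frequently not_less)
      then show False
      proof cases
        case 1
        then have "ereal s \<le> Liminf (at x) ?e" by (intro Liminf_bounded) simp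
        with s'(1) s(2) show False by (meson ereal_less(2) ereal_less_eq(3) leD less_imp_le order_trans)
      next
        case 2
        then have "Limsup (at x) ?e \<le> ereal t" by (intro Limsup_bounded) simp
        with t'(2) t(3) show False by (meson ereal_less_eq(3) leD less_imp_le order_trans)
      qed
    qed
    then have eq: "Liminf (at x) ?e = Limsup (at x) ?e"
      using Liminf_le_Limsup[of "at x" ?e] by auto
    have "\<forall>\<^sub>F y in at x. ?e y \<le> ereal B"
      by (rule eventually_mono[OF B]) (simp only: ereal_less_eq abs_le_iff)
    moreover have "\<forall>\<^sub>F y in at x. ereal (- B) \<le> ?e y"
      by (rule eventually_mono[OF B]) (simp only: ereal_less_eq abs_le_iff, linarith)
    ultimately have "Limsup (at x) ?e \<le> ereal B" "ereal (- B) \<le> Liminf (at x) ?e"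
      by - (intro Limsup_bounded Liminf_bounded; assumption)+
    then have "\<bar>Limsup (at x) ?e\<bar> \<noteq> \<infinity>" using eq by auto
    then obtain l where l: "Limsup (at x) ?e = ereal l" by (cases "Limsup (at x) ?e") auto
    have "(?e \<longlongrightarrow> ereal l) (at x)"
      by (rule Liminf_eq_Limsup) (use eq l in auto)
    then have "(?S x \<longlongrightarrow> l) (at x)" by simp
    then have "(f has_field_derivative l) (at x)" by (simp add: has_field_derivative_iff)
    then show False using x(2) by (meson field_differentiable_def field_differentiable_imp_differentiable)
  qed
qed

section \<open>Fundamental theorem of calculus and integration by parts\<close>

text \<open>Intervals tagged in N lie in an open set of measure below \<delta>, so their increments
  add up to less than e / 2. At every other tag f is linear up to c times the length of the
  interval, which costs at most e / 2 in total.\<close>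

theorem AC_on_fundamental_theorem_of_calculus:
  assumes "a \<le> b" and f: "AC_on a b f" and N: "negligible N"
    and deriv: "\<And>x. x \<in> {a..b} - N \<Longrightarrow> (f has_real_derivative f' x) (at x within {a..b})"
  shows "(f' has_integral (f b - f a)) {a..b}"
proof -
  let ?\<mu> = "measure lebesgue"
  let ?\<Delta> = "\<lambda>K. f (Sup K) - f (Inf K)"
  \<comment> \<open>With the value 0 on N, an interval tagged there enters the error only through
    its increment of f.\<close>
  define g where "g x = (if x \<in> N then 0 else f' x)" for x
  have "(g has_integral (f b - f a)) {a..b}"
    unfolding has_integral_real
  proof (intro allI impI)
    fix e :: real assume "0 < e"
    \<comment> \<open>The added 1 keeps the denominator positive when a = b.\<close>
    define c where "c = e / (2 * (b - a + 1))"
    have "0 < c" using \<open>0 < e\<close> \<open>a \<le> b\<close> by (simp add: c_def)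
    have half: "e / (2 * k) * k = e / 2" if "0 < k" for k using that by simp
    have "c * (b - a + 1) = e / 2" unfolding c_def by (rule half) (use \<open>a \<le> b\<close> in simp)
    moreover have "c * (b - a) \<le> c * (b - a + 1)" using \<open>0 < c\<close> by simp
    ultimately have cab: "c * (b - a) \<le> e / 2" by simp
    have "0 < e / 2" using \<open>0 < e\<close> by simp
    obtain \<delta> where "\<delta> > 0" and \<delta>: "\<And>p. p division_of \<Union>p \<Longrightarrow> \<Union>p \<subseteq> {a..b} \<Longrightarrow>
        (\<Sum>K\<in>p. ?\<mu> K) < \<delta> \<Longrightarrow> (\<Sum>K\<in>p. \<bar>?\<Delta> K\<bar>) < e / 2"
      by (rule AC_on_division[OF f \<open>0 < e / 2\<close>]) blast
    obtain U where U: "open U" "N \<subseteq> U" "U \<in> lmeasurable" "?\<mu> U < \<delta>"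
    proof -
      obtain U where "open U" "N \<subseteq> U" and m: "U - N \<in> lmeasurable" "emeasure lebesgue (U - N) < ennreal \<delta>"
        using sets_lebesgue_outer_open[of N \<delta>] negligible_imp_sets[OF N] \<open>\<delta> > 0\<close> by blast
      moreover have "U = (U - N) \<union> N" using \<open>N \<subseteq> U\<close> by blast
      moreover have "?\<mu> ((U - N) \<union> N) = ?\<mu> (U - N)"
        using m N by (intro measure_Un_null_set) (auto simp: negligible_iff_null_sets fmeasurableD)
      moreover have "(U - N) \<union> N \<in> lmeasurable" using m(1) negligible_imp_measurable[OF N] by (rule fmeasurable.Un)
      moreover have "?\<mu> (U - N) < \<delta>"
        using m \<open>\<delta> > 0\<close> by (simp add: emeasure_eq_measure2 ennreal_less_iff)
      ultimately show thesis using that[of U] by simp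
    qed
    have "\<exists>d>0. x \<in> {a..b} - N \<longrightarrow>
         (\<forall>y\<in>{a..b}. \<bar>y - x\<bar> < d \<longrightarrow> \<bar>f y - f x - f' x * (y - x)\<bar> \<le> c * \<bar>y - x\<bar>)" for x
      using deriv[of x] \<open>0 < c\<close> zero_less_one
      unfolding has_field_derivative_def has_derivative_within_alt real_norm_def by blast
    then obtain d where d: "\<And>x. 0 < d x"
      "\<And>x y. x \<in> {a..b} - N \<Longrightarrow> y \<in> {a..b} \<Longrightarrow> \<bar>y - x\<bar> < d x \<Longrightarrow>
          \<bar>f y - f x - f' x * (y - x)\<bar> \<le> c * \<bar>y - x\<bar>"
      by metis
    define \<gamma> where "\<gamma> x = (if x \<in> N then U else ball x (d x))" for x
    show "\<exists>\<gamma>. gauge \<gamma> \<and> (\<forall>D. D tagged_division_of {a..b} \<and> \<gamma> fine D \<longrightarrow>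
        norm ((\<Sum>(x, K)\<in>D. measure lborel K *\<^sub>R g x) - (f b - f a)) < e)"
    proof (intro exI conjI allI impI)
      show "gauge \<gamma>" using U(1,2) d(1) by (auto simp: gauge_def \<gamma>_def)
      fix D assume "D tagged_division_of {a..b} \<and> \<gamma> fine D"
      then have D: "D tagged_division_of {a..b}" and fine: "\<gamma> fine D" by auto
      note TD = tagged_division_ofD[OF D]
      have DK: "\<exists>u v. K = {u..v} \<and> u \<le> x \<and> x \<le> v \<and> a \<le> u \<and> v \<le> b" if xK: "(x, K) \<in> D" for x K
      proof -
        obtain u v where "K = cbox u v" using TD(4)[OF xK] by blast
        moreover have "x \<in> K" "K \<subseteq> {a..b}" using TD(2,3)[OF xK] by auto
        ultimately show ?thesis by (intro exI[of _ u] exI[of _ v]) auto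
      qed
      define D1 where "D1 = {(x, K) \<in> D. x \<in> N}"
      have D1: "D1 \<subseteq> D" "finite D1" using TD(1) by (auto simp: D1_def intro: finite_subset)
      \<comment> \<open>Two different tags of one interval would force it to have empty interior,
        hence to be a point, which admits one tag only. So no increment is lost on passing from
        \<open>D1\<close> to its intervals.\<close>
      have inj: "inj_on snd D1"
      proof (rule inj_onI, rule ccontr)
        fix s t assume st: "s \<in> D1" "t \<in> D1" "snd s = snd t" "s \<noteq> t"
        obtain x y K where xy: "s = (x, K)" "t = (y, K)" using st(3) by (metis prod.collapse)
        then have xyK: "(x, K) \<in> D" "(y, K) \<in> D" "x \<noteq> y" using st D1(1) by auto
        then have "interior K = {}" using TD(5)[of x K y K] by auto
        then show False using DK[OF xyK(1)] DK[OF xyK(2)] xyK(3) by auto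
      qed
      have sD1: "snd ` D1 division_of \<Union>(snd ` D1)"
        using partial_division_of_tagged_division[OF tagged_partial_division_subset[OF _ D1(1)]] D
        by (auto simp: tagged_division_of_def)
      have "\<Union>(snd ` D1) \<subseteq> U" using fine by (fastforce simp: D1_def fine_def \<gamma>_def)
      then have "?\<mu> (\<Union>(snd ` D1)) \<le> ?\<mu> U"
        using lmeasurable_division[OF sD1] U(3) by (intro measure_mono_fmeasurable) (auto simp: fmeasurableD)
      then have small: "(\<Sum>K\<in>snd ` D1. ?\<mu> K) < \<delta>" using U(4) content_division[OF sD1] by simp
      have "\<Union>(snd ` D1) \<subseteq> {a..b}" using TD(3) D1(1) by fastforce
      from \<delta>[OF sD1 this small] have sum1: "(\<Sum>(x, K)\<in>D1. \<bar>?\<Delta> K\<bar>) < e / 2"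
        by (simp add: sum.reindex[OF inj] case_prod_unfold)
      have len: "(\<Sum>(x, K)\<in>D. Sup K - Inf K) = b - a"
        using additive_tagged_division_1[OF \<open>a \<le> b\<close> D, of "\<lambda>x. x"] .
      \<comment> \<open>The interval is split at its tag x: the linear approximation is used at both
        end points, and their distances from x add up to its length.\<close>
      have good: "\<bar>measure lborel K * g x - ?\<Delta> K\<bar> \<le> c * (Sup K - Inf K)" if xK: "(x, K) \<in> D - D1" for x K
      proof -
        obtain u v where K: "K = {u..v}" "u \<le> x" "x \<le> v" "a \<le> u" "v \<le> b" using DK xK by blast
        have "x \<notin> N" using xK by (auto simp: D1_def)
        then have "K \<subseteq> ball x (d x)" using fine xK by (fastforce simp: fine_def \<gamma>_def)
        moreover have "u \<in> K" "v \<in> K" using K by auto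
        ultimately have "dist x u < d x" "dist x v < d x" by auto
        then have "\<bar>u - x\<bar> < d x" "\<bar>v - x\<bar> < d x" by (auto simp: dist_real_def)
        then have "\<bar>f u - f x - f' x * (u - x)\<bar> \<le> c * \<bar>u - x\<bar>" "\<bar>f v - f x - f' x * (v - x)\<bar> \<le> c * \<bar>v - x\<bar>"
          by (intro d(2); use K \<open>x \<notin> N\<close> in simp)+
        moreover have "measure lborel K * g x - ?\<Delta> K =
            (f u - f x - f' x * (u - x)) - (f v - f x - f' x * (v - x))"
          using K \<open>x \<notin> N\<close> by (simp add: g_def algebra_simps)
        moreover have "c * (Sup K - Inf K) = c * \<bar>u - x\<bar> + c * \<bar>v - x\<bar>" using K by (simp add: algebra_simps)
        ultimately show ?thesis by linarith
      qed
      have "(\<Sum>(x, K)\<in>D. measure lborel K *\<^sub>R g x) - (f b - f a) = (\<Sum>(x, K)\<in>D. measure lborel K * g x - ?\<Delta> K)"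
        by (simp add: additive_tagged_division_1[OF \<open>a \<le> b\<close> D, of f, symmetric] sum_subtractf case_prod_unfold)
      also have "\<dots> = (\<Sum>(x, K)\<in>D1. measure lborel K * g x - ?\<Delta> K) + (\<Sum>(x, K)\<in>D - D1. measure lborel K * g x - ?\<Delta> K)"
        using sum.subset_diff[OF D1(1) TD(1)] by (simp add: add.commute)
      finally have "\<bar>(\<Sum>(x, K)\<in>D. measure lborel K *\<^sub>R g x) - (f b - f a)\<bar> =
          \<bar>(\<Sum>(x, K)\<in>D1. measure lborel K * g x - ?\<Delta> K) + (\<Sum>(x, K)\<in>D - D1. measure lborel K * g x - ?\<Delta> K)\<bar>"
        by simp
      also have "\<dots> \<le> (\<Sum>(x, K)\<in>D1. \<bar>?\<Delta> K\<bar>) + (\<Sum>(x, K)\<in>D - D1. c * (Sup K - Inf K))"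
      proof (rule order_trans[OF abs_triangle_ineq add_mono])
        have "(\<Sum>(x, K)\<in>D1. measure lborel K * g x - ?\<Delta> K) = (\<Sum>(x, K)\<in>D1. - ?\<Delta> K)"
          by (intro sum.cong refl) (auto simp: D1_def g_def)
        also have "\<bar>\<dots>\<bar> \<le> (\<Sum>(x, K)\<in>D1. \<bar>?\<Delta> K\<bar>)"
          by (rule order_trans[OF sum_abs], intro sum_mono) auto
        finally show "\<bar>\<Sum>(x, K)\<in>D1. measure lborel K * g x - ?\<Delta> K\<bar> \<le> (\<Sum>(x, K)\<in>D1. \<bar>?\<Delta> K\<bar>)" .
        show "\<bar>\<Sum>(x, K)\<in>D - D1. measure lborel K * g x - ?\<Delta> K\<bar> \<le> (\<Sum>(x, K)\<in>D - D1. c * (Sup K - Inf K))"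
          by (rule order_trans[OF sum_abs], intro sum_mono) (use good in auto)
      qed
      finally have bound: "\<bar>(\<Sum>(x, K)\<in>D. measure lborel K *\<^sub>R g x) - (f b - f a)\<bar>
          \<le> (\<Sum>(x, K)\<in>D1. \<bar>?\<Delta> K\<bar>) + (\<Sum>(x, K)\<in>D - D1. c * (Sup K - Inf K))" .
      have "(\<Sum>(x, K)\<in>D - D1. c * (Sup K - Inf K)) \<le> (\<Sum>(x, K)\<in>D. c * (Sup K - Inf K))"
      proof (rule sum_mono2[OF TD(1)])
        fix s assume "s \<in> D - (D - D1)"
        then obtain x K where "s = (x, K)" "(x, K) \<in> D" by (cases s) auto
        then show "0 \<le> (case s of (x, K) \<Rightarrow> c * (Sup K - Inf K))"
          using DK[of x K] \<open>0 < c\<close> by auto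
      qed auto
      also have "\<dots> = c * (b - a)"
        unfolding len[symmetric] by (simp add: sum_distrib_left case_prod_unfold)
      finally show "norm ((\<Sum>(x, K)\<in>D. measure lborel K *\<^sub>R g x) - (f b - f a)) < e"
        using bound sum1 cab unfolding real_norm_def by linarith
    qed
  qed
  then show ?thesis
    by (rule has_integral_spike[OF N, rotated]) (simp add: g_def)
qed

lemma AC_on_imp_continuous_on:
  assumes "AC_on a b f"
  shows "continuous_on {a..b} f"
  unfolding continuous_on_iff
proof (intro ballI allI impI)
  fix x e :: real assume x: "x \<in> {a..b}" and "0 < e"
  obtain d where "d > 0" and d: "\<And>I :: (real \<times> real) set.
        finite I \<Longrightarrow> (\<forall>(u, v)\<in>I. a \<le> u \<and> u \<le> v \<and> v \<le> b) \<Longrightarrow>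
        disjoint_family_on (\<lambda>(u, v). {u<..<v}) I \<Longrightarrow> (\<Sum>(u, v)\<in>I. v - u) < d \<Longrightarrow>
        (\<Sum>(u, v)\<in>I. \<bar>f v - f u\<bar>) < e"
    using assms \<open>0 < e\<close> unfolding AC_on_def by meson
  have "\<bar>f y - f x\<bar> < e" if "y \<in> {a..b}" "dist y x < d" for y
    using d[of "{(min x y, max x y)}"] x that
    by (cases "x \<le> y") (auto simp: disjoint_family_on_def dist_real_def abs_minus_commute)
  then show "\<exists>d>0. \<forall>y\<in>{a..b}. dist y x < d \<longrightarrow> dist (f y) (f x) < e"
    using \<open>d > 0\<close> by (auto simp: dist_real_def)
qed

text \<open>In f v h v - f u h u = h v (f v - f u) + f u (h v - h u) the first term is small by
  absolute continuity and boundedness of h, the second is at most a constant times v - u.\<close>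

lemma AC_on_mult_Lipschitz:
  assumes f: "AC_on a b f" and h: "C-lipschitz_on {a..b} h"
  shows "AC_on a b (\<lambda>x. f x * h x)"
proof -
  have "bounded (f ` {a..b})" "bounded (h ` {a..b})"
    using AC_on_imp_continuous_on[OF f] lipschitz_on_continuous_on[OF h]
    by (auto intro!: compact_imp_bounded compact_continuous_image)
  then obtain B B' where B: "\<And>x. x \<in> {a..b} \<Longrightarrow> \<bar>f x\<bar> \<le> B" and B': "\<And>x. x \<in> {a..b} \<Longrightarrow> \<bar>h x\<bar> \<le> B'"
    unfolding bounded_iff by fastforce
  have C: "0 \<le> C" using h by (rule lipschitz_on_nonneg)
  show ?thesis
    unfolding AC_on_def
  proof (intro allI impI)
    fix e :: real assume "0 < e"
    \<comment> \<open>Both \<open>\<epsilon>\<close> and \<open>c\<close> below allot e / 2 to one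
      of the two terms; adding 1 keeps the denominators positive.\<close>
    define \<epsilon> where "\<epsilon> = e / (2 * (\<bar>B'\<bar> + 1))"
    have "0 < \<epsilon>" using \<open>0 < e\<close> by (simp add: \<epsilon>_def)
    then obtain d where "d > 0" and d: "\<And>I :: (real \<times> real) set.
        finite I \<Longrightarrow> (\<forall>(u, v)\<in>I. a \<le> u \<and> u \<le> v \<and> v \<le> b) \<Longrightarrow>
        disjoint_family_on (\<lambda>(u, v). {u<..<v}) I \<Longrightarrow> (\<Sum>(u, v)\<in>I. v - u) < d \<Longrightarrow>
        (\<Sum>(u, v)\<in>I. \<bar>f v - f u\<bar>) < \<epsilon>"
      using f unfolding AC_on_def by meson
    define c where "c = e / (2 * (\<bar>B\<bar> * C + 1))"
    have pos: "0 < \<bar>B\<bar> * C + 1" using C by (simp add: add_nonneg_pos)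
    have "0 < c" using \<open>0 < e\<close> pos by (simp add: c_def)
    show "\<exists>\<delta>>0. \<forall>I :: (real \<times> real) set.
        finite I \<and> (\<forall>(u, v)\<in>I. a \<le> u \<and> u \<le> v \<and> v \<le> b) \<and>
        disjoint_family_on (\<lambda>(u, v). {u<..<v}) I \<and> (\<Sum>(u, v)\<in>I. v - u) < \<delta>
        \<longrightarrow> (\<Sum>(u, v)\<in>I. \<bar>f v * h v - f u * h u\<bar>) < e"
    proof (intro exI[of _ "min d c"] conjI allI impI, goal_cases)
      case 1
      show ?case using \<open>0 < d\<close> \<open>0 < c\<close> by simp
    next
      case (2 I)
      then have I: "finite I" "\<forall>(u, v)\<in>I. a \<le> u \<and> u \<le> v \<and> v \<le> b"
        "disjoint_family_on (\<lambda>(u, v). {u<..<v}) I" "(\<Sum>(u, v)\<in>I. v - u) < d" "(\<Sum>(u, v)\<in>I. v - u) < c"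
        by auto
      have "\<bar>f v * h v - f u * h u\<bar> \<le> (\<bar>B'\<bar> + 1) * \<bar>f v - f u\<bar> + \<bar>B\<bar> * C * (v - u)" if "(u, v) \<in> I" for u v
      proof -
        have uv: "u \<in> {a..b}" "v \<in> {a..b}" "u \<le> v" using I(2) that by force+
        have "f v * h v - f u * h u = h v * (f v - f u) + f u * (h v - h u)" by (simp add: algebra_simps)
        then have "\<bar>f v * h v - f u * h u\<bar> \<le> \<bar>h v\<bar> * \<bar>f v - f u\<bar> + \<bar>f u\<bar> * \<bar>h v - h u\<bar>"
          by (metis abs_mult abs_triangle_ineq)
        also have "\<dots> \<le> (\<bar>B'\<bar> + 1) * \<bar>f v - f u\<bar> + \<bar>B\<bar> * (C * (v - u))"
          using lipschitz_onD[OF h uv(2,1)] B[OF uv(1)] B'[OF uv(2)] uv(3) C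
          by (intro add_mono mult_mono) (auto simp: dist_real_def)
        finally show ?thesis by (simp add: mult.assoc)
      qed
      then have "(\<Sum>(u, v)\<in>I. \<bar>f v * h v - f u * h u\<bar>)
          \<le> (\<Sum>(u, v)\<in>I. (\<bar>B'\<bar> + 1) * \<bar>f v - f u\<bar> + \<bar>B\<bar> * C * (v - u))"
        by (intro sum_mono) auto
      also have "\<dots> = (\<bar>B'\<bar> + 1) * (\<Sum>(u, v)\<in>I. \<bar>f v - f u\<bar>) + \<bar>B\<bar> * C * (\<Sum>(u, v)\<in>I. v - u)"
        by (simp add: sum.distrib sum_distrib_left case_prod_unfold)
      also have "\<dots> < (\<bar>B'\<bar> + 1) * \<epsilon> + (\<bar>B\<bar> * C + 1) * c"
      proof (rule add_less_le_mono)
        show "(\<bar>B'\<bar> + 1) * (\<Sum>(u, v)\<in>I. \<bar>f v - f u\<bar>) < (\<bar>B'\<bar> + 1) * \<epsilon>"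
          using d[OF I(1-4)] by (intro mult_strict_left_mono) auto
        show "\<bar>B\<bar> * C * (\<Sum>(u, v)\<in>I. v - u) \<le> (\<bar>B\<bar> * C + 1) * c"
          using I(5) C \<open>0 < c\<close> I(2) by (intro mult_mono sum_nonneg) auto
      qed
      also have "\<dots> = e"
      proof -
        have half: "k * (e / (2 * k)) = e / 2" if "0 < k" for k using that by simp
        have "(\<bar>B'\<bar> + 1) * \<epsilon> = e / 2" "(\<bar>B\<bar> * C + 1) * c = e / 2"
          unfolding \<epsilon>_def c_def by (rule half, use pos in simp)+
        then show ?thesis by simp
      qed
      finally show ?case .
    qed
  qed
qed

text \<open>The derivative of H is bounded by compactness, so H is Lipschitz and f H is absolutely
  continuous; the fundamental theorem is applied to this product.\<close>

lemma AC_on_integration_by_parts: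
  assumes "a \<le> b" and f: "AC_on a b f"
    and H: "\<And>x. x \<in> {a..b} \<Longrightarrow> (H has_real_derivative H' x) (at x within {a..b})"
    and H': "continuous_on {a..b} H'"
  shows "((\<lambda>x. deriv f x * H x + f x * H' x) has_integral (f b * H b - f a * H a)) {a..b}"
proof (rule AC_on_fundamental_theorem_of_calculus[OF \<open>a \<le> b\<close>])
  have "bounded (H' ` {a..b})" using H' by (auto intro!: compact_imp_bounded compact_continuous_image)
  then obtain C where C: "\<And>x. x \<in> {a..b} \<Longrightarrow> \<bar>H' x\<bar> \<le> C" unfolding bounded_iff by fastforce
  have "\<bar>C\<bar>-lipschitz_on {a..b} H"
  proof (rule lipschitz_onI)
    fix x y assume "x \<in> {a..b}" "y \<in> {a..b}"
    then have "norm (H x - H y) \<le> \<bar>C\<bar> * norm (x - y)"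
      by (intro field_differentiable_bound[of "{a..b}" H H']) (use H C in \<open>force+\<close>)
    then show "dist (H x) (H y) \<le> \<bar>C\<bar> * dist x y" by (simp add: dist_norm)
  qed simp
  then show "AC_on a b (\<lambda>x. f x * H x)" by (rule AC_on_mult_Lipschitz[OF f])
  \<comment> \<open>The end points are added because \<open>deriv\<close> is two-sided, while f is
    controlled only on [a,b].\<close>
  let ?N = "{x \<in> {a<..<b}. \<not> f differentiable (at x)} \<union> {a, b}"
  show "negligible ?N" using AC_on_imp_differentiable_ae[OF f] by (simp add: negligible_Un)
  fix x assume x: "x \<in> {a..b} - ?N"
  then have "f differentiable (at x)" by auto
  then have "(f has_real_derivative deriv f x) (at x within {a..b})"
    using DERIV_deriv_iff_real_differentiable has_field_derivative_at_within by blast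
  from DERIV_mult[OF this H[of x]] show "((\<lambda>x. f x * H x) has_real_derivative deriv f x * H x + f x * H' x) (at x within {a..b})"
    using x by (simp add: algebra_simps)
qed

section \<open>Duality of the fractional integrals\<close>

text \<open>Fubini for g x k (x - t) h t: translation invariance bounds the integral over x of its
  modulus by B times the L1 norm of k times the modulus of h t, which is integrable in t.\<close>

lemma convolution_duality:
  fixes k g h :: "real \<Rightarrow> real"
  assumes k: "integrable lborel k" and h: "integrable lebesgue h"
    and g [measurable]: "g \<in> borel_measurable borel" and gB: "\<And>x. \<bar>g x\<bar> \<le> B"
  shows "integrable lebesgue (\<lambda>x. g x * (LINT t|lebesgue. k (x - t) * h t))" (is ?int1)
    and "integrable lebesgue (\<lambda>t. h t * (LINT x|lebesgue. k (x - t) * g x))" (is ?int2)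
    and "(LINT x|lebesgue. g x * (LINT t|lebesgue. k (x - t) * h t)) =
         (LINT t|lebesgue. h t * (LINT x|lebesgue. k (x - t) * g x))" (is ?eq)
proof -
  have k_meas [measurable]: "k \<in> borel_measurable borel" using borel_measurable_integrable[OF k] by simp
  \<comment> \<open>The product measure is built from \<open>lborel\<close>, so h is replaced by a
    Borel function that agrees with it almost everywhere.\<close>
  obtain h' where h' [measurable]: "h' \<in> borel_measurable borel" and hh': "AE t in lebesgue. h t = h' t"
    using completion_ex_borel_measurable_real[OF borel_measurable_integrable[OF h]]
    by (auto dest: AE_completion)
  have h_meas [measurable]: "h \<in> borel_measurable lebesgue" using borel_measurable_integrable[OF h] .
  have lebesgue_meas: "u \<in> borel_measurable lebesgue" if "u \<in> borel_measurable borel" for u :: "real \<Rightarrow> real"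
    using that by (simp add: measurable_completion)
  have h'_int: "integrable lborel h'"
  proof -
    have "integrable lebesgue h'"
      by (rule integrable_cong_AE_imp[OF h]) (use hh' lebesgue_meas[OF h'] in auto)
    then show ?thesis by (simp add: integrable_completion)
  qed
  have inner1: "(LINT t|lebesgue. k (x - t) * h t) = (LINT t|lborel. k (x - t) * h' t)" for x
  proof -
    have "(LINT t|lebesgue. k (x - t) * h t) = (LINT t|lebesgue. k (x - t) * h' t)"
    proof (rule integral_cong_AE)
      show "AE t in lebesgue. k (x - t) * h t = k (x - t) * h' t" using hh' by eventually_elim simp
      have [measurable]: "(\<lambda>t. k (x - t)) \<in> borel_measurable lebesgue" by (rule lebesgue_meas) simp
      show "(\<lambda>t. k (x - t) * h t) \<in> borel_measurable lebesgue" by simp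
      show "(\<lambda>t. k (x - t) * h' t) \<in> borel_measurable lebesgue" by (rule lebesgue_meas) simp
    qed
    then show ?thesis by (simp add: integral_completion)
  qed
  have inner2: "(LINT x|lebesgue. k (x - t) * g x) = (LINT x|lborel. k (x - t) * g x)" for t
    by (rule integral_completion) simp
  define f where "f t x = g x * (k (x - t) * h' t)" for t x
  have f_meas: "case_prod f \<in> borel_measurable (lborel \<Otimes>\<^sub>M lborel)"
    unfolding f_def by measurable
  have k_shift: "integrable lborel (\<lambda>x. k (x - t))" for t
    using lborel_integrable_real_affine[OF k, of 1 "- t"] by simp
  have gk: "integrable lborel (\<lambda>x. g x * k (x - t))" for t
  proof (rule Bochner_Integration.integrable_bound)
    show "integrable lborel (\<lambda>x. B * k (x - t))" using k_shift by simp
    have "\<bar>g x\<bar> \<le> \<bar>B\<bar>" for x using gB[of x] by simp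
    then show "AE x in lborel. norm (g x * k (x - t)) \<le> norm (B * k (x - t))"
      by (auto simp: abs_mult intro!: mult_right_mono)
  qed simp
  have f_int: "integrable (lborel \<Otimes>\<^sub>M lborel) (case_prod f)"
  proof (rule lborel_pair.Fubini_integrable[OF f_meas])
    show "AE t in lborel. integrable lborel (\<lambda>x. case (t, x) of (t, x) \<Rightarrow> f t x)"
      using gk by (simp add: f_def mult.assoc[symmetric])
    have "0 \<le> B" using gB[of 0] by linarith
    show "integrable lborel (\<lambda>t. LINT x|lborel. norm (case (t, x) of (t, x) \<Rightarrow> f t x))"
    proof (rule Bochner_Integration.integrable_bound)
      show "integrable lborel (\<lambda>t. B * (LINT x|lborel. \<bar>k x\<bar>) * h' t)" using h'_int by simp
      show "(\<lambda>t. LINT x|lborel. norm (case (t, x) of (t, x) \<Rightarrow> f t x)) \<in> borel_measurable lborel"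
        using f_meas by measurable
      have "(LINT x|lborel. \<bar>f t x\<bar>) \<le> B * (LINT x|lborel. \<bar>k x\<bar>) * \<bar>h' t\<bar>" for t
      proof -
        have "(LINT x|lborel. \<bar>f t x\<bar>) \<le> (LINT x|lborel. B * \<bar>h' t\<bar> * \<bar>k (x - t)\<bar>)"
        proof (rule integral_mono)
          show "integrable lborel (\<lambda>x. \<bar>f t x\<bar>)"
            using gk[of t] by (simp add: f_def mult.assoc[symmetric])
          show "integrable lborel (\<lambda>x. B * \<bar>h' t\<bar> * \<bar>k (x - t)\<bar>)" using k_shift by simp
          show "\<bar>f t x\<bar> \<le> B * \<bar>h' t\<bar> * \<bar>k (x - t)\<bar>" for x
          proof -
            have "\<bar>f t x\<bar> = \<bar>g x\<bar> * (\<bar>h' t\<bar> * \<bar>k (x - t)\<bar>)" by (simp add: f_def abs_mult)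
            also have "\<dots> \<le> B * (\<bar>h' t\<bar> * \<bar>k (x - t)\<bar>)" using gB by (intro mult_right_mono) auto
            finally show ?thesis by simp
          qed
        qed
        also have "\<dots> = B * \<bar>h' t\<bar> * (LINT x|lborel. \<bar>k (x - t)\<bar>)" by simp
        also have "(LINT x|lborel. \<bar>k (x - t)\<bar>) = (LINT x|lborel. \<bar>k x\<bar>)"
          using lborel_integral_real_affine[of 1 "\<lambda>x. \<bar>k x\<bar>" "- t"] by simp
        finally show ?thesis by (simp add: mult_ac)
      qed
      moreover have "0 \<le> (LINT x|lborel. \<bar>k x\<bar>)" by simp
      ultimately show "AE t in lborel. norm (LINT x|lborel. norm (case (t, x) of (t, x) \<Rightarrow> f t x))
          \<le> norm (B * (LINT x|lborel. \<bar>k x\<bar>) * h' t)"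
        using \<open>0 \<le> B\<close> by (simp add: abs_mult)
    qed
  qed
  have fst_eq: "(LINT x|lborel. f t x) = h' t * (LINT x|lborel. k (x - t) * g x)" for t
  proof -
    have "f t x = h' t * (k (x - t) * g x)" for x by (simp add: f_def)
    then show ?thesis by simp
  qed
  have snd_eq: "(LINT t|lborel. f t x) = g x * (LINT t|lborel. k (x - t) * h' t)" for x
    by (simp add: f_def)
  have i1: "integrable lborel (\<lambda>x. g x * (LINT t|lborel. k (x - t) * h' t))"
    using lborel_pair.integrable_snd[OF f_int] by (simp add: snd_eq)
  have i2: "integrable lborel (\<lambda>t. h' t * (LINT x|lborel. k (x - t) * g x))"
    using lborel_pair.integrable_fst[OF f_int] by (simp add: fst_eq)
  have lborel_eq: "(LINT x|lborel. g x * (LINT t|lborel. k (x - t) * h' t)) =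
      (LINT t|lborel. h' t * (LINT x|lborel. k (x - t) * g x))"
    using lborel_pair.Fubini_integral[OF f_int] by (simp add: fst_eq snd_eq)
  have m1: "(\<lambda>x. g x * (LINT t|lborel. k (x - t) * h' t)) \<in> borel_measurable lborel"
    and m2: "(\<lambda>t. h' t * (LINT x|lborel. k (x - t) * g x)) \<in> borel_measurable lborel"
    using i1 i2 by (auto dest: borel_measurable_integrable)
  have [measurable]: "(\<lambda>t. LINT x|lborel. k (x - t) * g x) \<in> borel_measurable lebesgue"
    by (rule lebesgue_meas) measurable
  have h_prod: "(\<lambda>t. h t * (LINT x|lborel. k (x - t) * g x)) \<in> borel_measurable lebesgue"
    by simp
  have ae: "AE t in lebesgue. h' t * (LINT x|lborel. k (x - t) * g x) = h t * (LINT x|lborel. k (x - t) * g x)"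
    using hh' by eventually_elim simp
  show ?int1 using i1 integrable_completion[OF m1] by (simp add: inner1)
  have i2': "integrable lebesgue (\<lambda>t. h' t * (LINT x|lborel. k (x - t) * g x))"
    using i2 integrable_completion[OF m2] by simp
  have ae': "AE t in lebesgue. h t * (LINT x|lborel. k (x - t) * g x) = h' t * (LINT x|lborel. k (x - t) * g x)"
    using ae by eventually_elim (rule sym)
  from integrable_cong_AE_imp[OF i2' h_prod ae] show ?int2 by (simp add: inner2)
  have "(LINT t|lebesgue. h t * (LINT x|lborel. k (x - t) * g x)) =
      (LINT t|lebesgue. h' t * (LINT x|lborel. k (x - t) * g x))"
    by (rule integral_cong_AE[OF h_prod borel_measurable_integrable[OF i2'] ae'])
  then show ?eq
    using lborel_eq integral_completion[OF m1] integral_completion[OF m2] by (simp add: inner1 inner2)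
qed

lemma integrable_truncated_powr:
  fixes \<mu> c :: real
  assumes "0 < \<mu>" and "0 \<le> c"
  shows "integrable lborel (\<lambda>u. indicator {0..c} u * u powr (\<mu> - 1))"
proof -
  have "(\<lambda>u. u powr (\<mu> - 1)) absolutely_integrable_on {0..c}"
    by (intro nonnegative_absolutely_integrable_1 integrable_on_powr_from_0) (use assms in auto)
  then show ?thesis by (simp add: set_integrable_def integrable_completion)
qed

text \<open>On [a,b] the left integral is convolution with a truncated power k and the right one is
  convolution with its reflection. Convolution duality for k gives the first three claims, for the
  reflected kernel the last three.\<close>

lemma RL_int_duality:
  assumes "a \<le> b" and \<mu>: "0 < \<mu>" and h: "set_integrable lebesgue {a..b} h" and g: "continuous_on {a..b} g"
  shows "set_integrable lebesgue {a..b} (\<lambda>x. g x * RL_int_left a \<mu> h x)"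
    and "set_integrable lebesgue {a..b} (\<lambda>x. h x * RL_int_right b \<mu> g x)"
    and "(LINT x:{a..b}|lebesgue. g x * RL_int_left a \<mu> h x) =
         (LINT x:{a..b}|lebesgue. h x * RL_int_right b \<mu> g x)"
    and "set_integrable lebesgue {a..b} (\<lambda>x. g x * RL_int_right b \<mu> h x)"
    and "set_integrable lebesgue {a..b} (\<lambda>x. h x * RL_int_left a \<mu> g x)"
    and "(LINT x:{a..b}|lebesgue. g x * RL_int_right b \<mu> h x) =
         (LINT x:{a..b}|lebesgue. h x * RL_int_left a \<mu> g x)"
proof -
  let ?I = "indicator {a..b} :: real \<Rightarrow> real"
  \<comment> \<open>For x and t in [a,b], the condition 0 \<le> x - t selects the range of the left
    integral, and x - t \<le> b - a always holds. Cutting off at b - a makes k integrable on the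
    whole line.\<close>
  define k where "k u = indicator {0..b - a} u * u powr (\<mu> - 1)" for u :: real
  define gg where "gg x = ?I x * g x" for x
  define hh where "hh x = ?I x * h x" for x
  have k: "integrable lborel k"
    unfolding k_def using integrable_truncated_powr[OF \<mu>] \<open>a \<le> b\<close> by simp
  have k': "integrable lborel (\<lambda>u. k (- u))"
    using lborel_integrable_real_affine[OF k, of "-1" 0] by simp
  have hh: "integrable lebesgue hh" using h by (simp add: set_integrable_def hh_def[abs_def])
  have gg: "gg \<in> borel_measurable borel"
    using borel_measurable_continuous_on_indicator[OF _ g] by (simp add: gg_def[abs_def])
  have "bounded (g ` {a..b})" using g by (auto intro!: compact_imp_bounded compact_continuous_image)
  then obtain B where "\<And>x. x \<in> {a..b} \<Longrightarrow> \<bar>g x\<bar> \<le> B" unfolding bounded_iff by fastforce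
  then have B: "\<bar>gg x\<bar> \<le> \<bar>B\<bar>" for x by (force simp: gg_def indicator_def)
  have left: "RL_int_left a \<mu> f x = 1 / Gamma \<mu> * (LINT t|lebesgue. k (x - t) * (?I t * f t))"
    if "x \<in> {a..b}" for f x
    unfolding RL_int_left_def set_lebesgue_integral_def
    by (intro arg_cong2[of _ _ _ _ "(*)"] refl Bochner_Integration.integral_cong)
      (use that in \<open>auto simp: k_def indicator_def\<close>)
  have right: "RL_int_right b \<mu> f x = 1 / Gamma \<mu> * (LINT t|lebesgue. k (t - x) * (?I t * f t))"
    if "x \<in> {a..b}" for f x
    unfolding RL_int_right_def set_lebesgue_integral_def
    by (intro arg_cong2[of _ _ _ _ "(*)"] refl Bochner_Integration.integral_cong)
      (use that in \<open>auto simp: k_def indicator_def\<close>)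
  note D = convolution_duality[OF k hh gg B] and D' = convolution_duality[OF k' hh gg B]
  let ?c = "1 / Gamma \<mu>"
  have e1: "?I x *\<^sub>R (g x * RL_int_left a \<mu> h x) = ?c * (gg x * (LINT t|lebesgue. k (x - t) * hh t))" for x
    by (cases "x \<in> {a..b}") (simp_all add: gg_def left hh_def)
  have e2: "?I x *\<^sub>R (h x * RL_int_right b \<mu> g x) = ?c * (hh x * (LINT t|lebesgue. k (t - x) * gg t))" for x
    by (cases "x \<in> {a..b}") (simp_all add: gg_def right hh_def)
  have e3: "?I x *\<^sub>R (g x * RL_int_right b \<mu> h x) = ?c * (gg x * (LINT t|lebesgue. k (- (x - t)) * hh t))" for x
    by (cases "x \<in> {a..b}") (simp_all add: gg_def right hh_def)
  have e4: "?I x *\<^sub>R (h x * RL_int_left a \<mu> g x) = ?c * (hh x * (LINT t|lebesgue. k (- (t - x)) * gg t))" for x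
    by (cases "x \<in> {a..b}") (simp_all add: gg_def left hh_def)
  show "set_integrable lebesgue {a..b} (\<lambda>x. g x * RL_int_left a \<mu> h x)"
    unfolding set_integrable_def e1 using D(1) by (rule integrable_mult_right)
  show "set_integrable lebesgue {a..b} (\<lambda>x. h x * RL_int_right b \<mu> g x)"
    unfolding set_integrable_def e2 using D(2) by (rule integrable_mult_right)
  show "(LINT x:{a..b}|lebesgue. g x * RL_int_left a \<mu> h x) =
         (LINT x:{a..b}|lebesgue. h x * RL_int_right b \<mu> g x)"
    unfolding set_lebesgue_integral_def e1 e2 integral_mult_right_zero D(3) ..
  show "set_integrable lebesgue {a..b} (\<lambda>x. g x * RL_int_right b \<mu> h x)"
    unfolding set_integrable_def e3 using D'(1) by (rule integrable_mult_right)
  show "set_integrable lebesgue {a..b} (\<lambda>x. h x * RL_int_left a \<mu> g x)"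
    unfolding set_integrable_def e4 using D'(2) by (rule integrable_mult_right)
  show "(LINT x:{a..b}|lebesgue. g x * RL_int_right b \<mu> h x) =
         (LINT x:{a..b}|lebesgue. h x * RL_int_left a \<mu> g x)"
    unfolding set_lebesgue_integral_def e3 e4 integral_mult_right_zero D'(3) ..
qed

section \<open>Integration by parts for the combined Caputo derivative\<close>

text \<open>Off the point s, h is the product of the bounded function v and the integrable function
  w h.\<close>

lemma set_integrable_singular_weight_cancel:
  fixes w v h :: "real \<Rightarrow> real"
  assumes wh: "set_integrable lebesgue {a..b} (\<lambda>t. w t * h t)"
    and v: "continuous_on {a..b} v" and vw: "\<And>t. t \<in> {a..b} - {s} \<Longrightarrow> v t * w t = 1"
  shows "set_integrable lebesgue {a..b} h"
proof (rule absolutely_integrable_spike)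
  show "(\<lambda>t. v t * (w t * h t)) absolutely_integrable_on {a..b}"
  proof (rule absolutely_integrable_bounded_measurable_product_real[OF _ _ _ wh])
    show "v \<in> borel_measurable (lebesgue_on {a..b})"
      using v by (rule continuous_imp_measurable_on_sets_lebesgue) simp
    show "bounded (v ` {a..b})"
      using v by (intro compact_imp_bounded compact_continuous_image) auto
  qed simp
  show "h t = v t * (w t * h t)" if "t \<in> {a..b} - {s}" for t
    using vw[OF that] by (simp add: mult.assoc[symmetric])
qed simp

text \<open>The left Caputo integral at b and the right one at a extend over all of [a,b], and their
  weights have the continuous reciprocals (b - t)^\<alpha> and (t - a)^\<beta>. At least one of the
  two is present for every \<gamma>.\<close>

lemma deriv_integrable_if_combined_Caputo_exists:
  assumes "a < b" and \<alpha>: "0 < \<alpha>" "\<alpha> < 1" and \<beta>: "0 < \<beta>" "\<beta> < 1"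
    and ex: "\<And>x. x \<in> {a..b} \<Longrightarrow> combined_Caputo_exists a b \<alpha> \<beta> \<gamma> f x"
  shows "set_integrable lebesgue {a..b} (deriv f)"
proof (cases "\<gamma> = 0")
  case False
  then have "set_integrable lebesgue {a..b} (\<lambda>t. (b - t) powr (1 - \<alpha> - 1) * deriv f t)"
    using ex[of b] \<open>a < b\<close>
    by (auto simp: combined_Caputo_exists_def Caputo_left_exists_def RL_int_left_exists_def)
  then show ?thesis
  proof (rule set_integrable_singular_weight_cancel)
    show "continuous_on {a..b} (\<lambda>t. (b - t) powr \<alpha>)"
      using \<alpha> by (intro continuous_on_powr' continuous_intros) auto
    show "(b - t) powr \<alpha> * (b - t) powr (1 - \<alpha> - 1) = 1" if "t \<in> {a..b} - {b}" for t
      using that by (simp flip: powr_add)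
  qed
next
  case True
  then have "set_integrable lebesgue {a..b} (\<lambda>t. (t - a) powr (1 - \<beta> - 1) * deriv f t)"
    using ex[of a] \<open>a < b\<close>
    by (auto simp: combined_Caputo_exists_def Caputo_right_exists_def RL_int_right_exists_def)
  then show ?thesis
  proof (rule set_integrable_singular_weight_cancel)
    show "continuous_on {a..b} (\<lambda>t. (t - a) powr \<beta>)"
      using \<beta> by (intro continuous_on_powr' continuous_intros) auto
    show "(t - a) powr \<beta> * (t - a) powr (1 - \<beta> - 1) = 1" if "t \<in> {a..b} - {a}" for t
      using that by (simp flip: powr_add)
  qed
qed

lemma combined_RL_primitive:
  assumes "x \<in> {a..b}" and "a < b" and ex: "combined_RL_exists a b \<mu> \<nu> \<eta> g x"
  shows "((\<lambda>x. (1 - \<eta>) * RL_int_right b (1 - \<nu>) g x - \<eta> * RL_int_left a (1 - \<mu>) g x)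
    has_real_derivative - combined_RL a b \<mu> \<nu> \<eta> g x) (at x within {a..b})"
proof -
  have vd: "(F has_real_derivative vector_derivative F (at x within {a..b})) (at x within {a..b})"
    if "F differentiable (at x within {a..b})" for F :: "real \<Rightarrow> real"
    using that vector_derivative_works has_real_derivative_iff_has_vector_derivative by blast
  \<comment> \<open>A summand with coefficient 0 is not assumed differentiable, but it is then
    constantly 0. The same applies to the right summand.\<close>
  have left: "((\<lambda>x. \<eta> * RL_int_left a (1 - \<mu>) g x) has_real_derivative \<eta> * RL_deriv_left a b \<mu> g x)
      (at x within {a..b})"
  proof (cases "\<eta> = 0")
    case False
    then show ?thesis
      using ex by (auto simp: combined_RL_exists_def RL_deriv_left_exists_def RL_deriv_left_def
          intro!: DERIV_cmult vd)
  qed simp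
  have right: "((\<lambda>x. (1 - \<eta>) * RL_int_right b (1 - \<nu>) g x) has_real_derivative
      - ((1 - \<eta>) * RL_deriv_right a b \<nu> g x)) (at x within {a..b})"
  proof (cases "\<eta> = 1")
    case False
    then have "RL_int_right b (1 - \<nu>) g differentiable (at x within {a..b})"
      using ex by (auto simp: combined_RL_exists_def RL_deriv_right_exists_def)
    from DERIV_cmult[OF vd[OF this], of "1 - \<eta>"] show ?thesis
      by (simp add: RL_deriv_right_def)
  qed simp
  show ?thesis
    by (rule DERIV_cong[OF DERIV_diff[OF right left]]) (simp add: combined_RL_def)
qed

text \<open>The second assumption in \<open>RL\<close> is one component of the Euler-Lagrange
  equation, with P for partial_y F and g for partial_v F. The boundary terms are kept because f need
  not vanish at the end points; they cancel later between functions with equal boundary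
  values.\<close>

lemma combined_Caputo_integration_by_parts:
  assumes ab: "a < b" and \<alpha>: "0 < \<alpha>" "\<alpha> < 1" and \<beta>: "0 < \<beta>" "\<beta> < 1"
    and f: "AC_on a b f"
    and ex: "\<And>x. x \<in> {a..b} \<Longrightarrow> combined_Caputo_exists a b \<alpha> \<beta> \<gamma> f x"
    and g: "continuous_on {a..b} g" and P: "continuous_on {a..b} P"
    and RL: "\<And>x. x \<in> {a..b} \<Longrightarrow> combined_RL_exists a b \<beta> \<alpha> (1 - \<gamma>) g x"
      "\<And>x. x \<in> {a..b} \<Longrightarrow> P x + combined_RL a b \<beta> \<alpha> (1 - \<gamma>) g x = 0"
  defines "H \<equiv> \<lambda>x. \<gamma> * RL_int_right b (1 - \<alpha>) g x - (1 - \<gamma>) * RL_int_left a (1 - \<beta>) g x"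
  shows "(LINT x:{a..b}|lebesgue. g x * combined_Caputo a b \<alpha> \<beta> \<gamma> f x) =
    f b * H b - f a * H a - (LINT x:{a..b}|lebesgue. f x * P x)"
proof -
  let ?h = "deriv f"
  have h: "set_integrable lebesgue {a..b} ?h"
    by (rule deriv_integrable_if_combined_Caputo_exists[OF ab \<alpha> \<beta> ex])
  have "0 < 1 - \<alpha>" "0 < 1 - \<beta>" using \<alpha> \<beta> by auto
  note A = RL_int_duality[OF less_imp_le[OF ab] \<open>0 < 1 - \<alpha>\<close> h g]
    and B = RL_int_duality[OF less_imp_le[OF ab] \<open>0 < 1 - \<beta>\<close> h g]
  have eq1: "g x * combined_Caputo a b \<alpha> \<beta> \<gamma> f x =
      \<gamma> * (g x * RL_int_left a (1 - \<alpha>) ?h x) - (1 - \<gamma>) * (g x * RL_int_right b (1 - \<beta>) ?h x)" for x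
    by (simp add: combined_Caputo_def Caputo_left_def Caputo_right_def algebra_simps)
  have eq2: "?h x * H x = \<gamma> * (?h x * RL_int_right b (1 - \<alpha>) g x) - (1 - \<gamma>) * (?h x * RL_int_left a (1 - \<beta>) g x)" for x
    by (simp add: H_def algebra_simps)
  have hH: "set_integrable lebesgue {a..b} (\<lambda>x. ?h x * H x)"
    unfolding eq2 by (intro set_integral_diff set_integrable_mult_right A B)
  have "(LINT x:{a..b}|lebesgue. g x * combined_Caputo a b \<alpha> \<beta> \<gamma> f x) = (LINT x:{a..b}|lebesgue. ?h x * H x)"
    unfolding eq1 eq2
    by (simp add: set_integral_diff set_integrable_mult_right A B)
  moreover have fP: "set_integrable lebesgue {a..b} (\<lambda>x. f x * P x)"
    using AC_on_imp_continuous_on[OF f] P by (intro absolutely_integrable_continuous_real continuous_on_mult)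
  \<comment> \<open>H is the primitive of \<open>combined_RL_primitive\<close> for \<eta> = 1 -
    \<gamma>, so its derivative is minus the combined Riemann-Liouville derivative of g, which
    equals P.\<close>
  have "(H has_real_derivative P x) (at x within {a..b})" if "x \<in> {a..b}" for x
    using combined_RL_primitive[OF that ab RL(1)[OF that]] RL(2)[OF that]
    by (simp add: H_def eq_neg_iff_add_eq_0[symmetric])
  from AC_on_integration_by_parts[OF less_imp_le[OF ab] f this P]
  have "((\<lambda>x. ?h x * H x + f x * P x) has_integral f b * H b - f a * H a) {a..b}" .
  then have "(LINT x:{a..b}|lebesgue. ?h x * H x + f x * P x) = f b * H b - f a * H a"
    using set_lebesgue_integral_eq_integral(2)[OF set_integral_add(1)[OF hH fP]] integral_unique by metis
  ultimately show ?thesis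
    using set_integral_add(2)[OF hH fP] by simp
qed

section \<open>Continuity of partial derivatives along admissible functions\<close>

lemma C1_on_imp_continuous_on: "C1_on S f \<Longrightarrow> continuous_on S f"
  unfolding C1_on_def by (auto intro: has_derivative_continuous_on)

text \<open>F is differentiable only relative to S, so the chain rule is used within the range of
  the line c. As the whole line lies in S, the resulting derivative is two-sided, as
  \<open>deriv\<close> demands.\<close>

lemma has_derivative_along_segment_imp_deriv:
  fixes F :: "'a :: real_normed_vector \<Rightarrow> real" and A :: "'a \<Rightarrow>\<^sub>L real"
  assumes F: "(F has_derivative blinfun_apply A) (at p within S)"
    and c: "\<And>s. c s = p + (s - s0) *\<^sub>R e" and S: "range c \<subseteq> S"
  shows "deriv (\<lambda>s. F (c s)) s0 = blinfun_apply A e"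
proof -
  have c0: "c s0 = p" by (simp add: c)
  have c': "(c has_derivative (\<lambda>s. s *\<^sub>R e)) (at s0)"
    unfolding c[abs_def] by (auto intro!: derivative_eq_intros)
  have "(F has_derivative blinfun_apply A) (at (c s0) within range c)"
    using F S unfolding c0 by (rule has_derivative_subset)
  from has_derivative_in_compose[OF c' this]
  have "((\<lambda>s. F (c s)) has_derivative (\<lambda>s. A (s *\<^sub>R e))) (at s0)" .
  then have "((\<lambda>s. F (c s)) has_real_derivative A e) (at s0)"
    by (simp add: has_field_derivative_def blinfun.scaleR_right mult_commute_abs)
  then show ?thesis by (rule DERIV_imp_deriv)
qed

text \<open>Varying one coordinate of y or v never leaves X \<times> UNIV, so each partial
  derivative is the continuous total derivative evaluated at a fixed coordinate vector.\<close>

lemma continuous_on_partial: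
  fixes F :: "real \<times> (real ^ 'n) \<times> (real ^ 'n) \<Rightarrow> real"
  assumes "C1_on (X \<times> UNIV) F"
  shows "continuous_on (X \<times> UNIV) (partial_y i F)" and "continuous_on (X \<times> UNIV) (partial_v i F)"
proof -
  obtain F' where F': "\<And>p. p \<in> X \<times> UNIV \<Longrightarrow> (F has_derivative blinfun_apply (F' p)) (at p within X \<times> UNIV)"
    and cont: "continuous_on (X \<times> UNIV) F'"
    using assms unfolding C1_on_def by blast
  have upd: "(\<chi> k. if k = i then s else w $ k) = w + (s - w $ i) *\<^sub>R axis i 1" for s and w :: "real ^ 'n"
    by (simp add: vec_eq_iff axis_def)
  have y: "partial_y i F p = F' p (0, axis i 1, 0)" if "p \<in> X \<times> UNIV" for p
  proof -
    obtain x y v where p: "p = (x, y, v)" by (cases p)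
    show ?thesis
      unfolding partial_y_def p case_prod_conv
      by (rule has_derivative_along_segment_imp_deriv[OF F'[OF that, unfolded p]])
        (use that p upd in auto)
  qed
  have v: "partial_v i F p = F' p (0, 0, axis i 1)" if "p \<in> X \<times> UNIV" for p
  proof -
    obtain x y v where p: "p = (x, y, v)" by (cases p)
    show ?thesis
      unfolding partial_v_def p case_prod_conv
      by (rule has_derivative_along_segment_imp_deriv[OF F'[OF that, unfolded p]])
        (use that p upd in auto)
  qed
  have "continuous_on (X \<times> UNIV) (\<lambda>p. F' p e)" for e
    using cont by (intro blinfun.continuous_on continuous_on_const)
  then show "continuous_on (X \<times> UNIV) (partial_y i F)" "continuous_on (X \<times> UNIV) (partial_v i F)"
    using y v by (simp_all cong: continuous_on_cong_simp)
qed

lemma Caputo_space_continuous_on: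
  assumes "y \<in> Caputo_space a b \<alpha> \<beta> \<gamma>"
  shows "continuous_on {a..b} y" and "continuous_on {a..b} (vec_Caputo a b \<alpha> \<beta> \<gamma> y)"
    and "continuous_on {a..b} (bracket a b \<alpha> \<beta> \<gamma> y)"
proof -
  have "continuous_on {a..b} (\<lambda>t. \<chi> i. y t $ i)"
    using assms by (intro continuous_on_vec_lambda AC_on_imp_continuous_on) (auto simp: Caputo_space_def)
  then show y: "continuous_on {a..b} y" by simp
  show v: "continuous_on {a..b} (vec_Caputo a b \<alpha> \<beta> \<gamma> y)"
    using assms by (simp add: Caputo_space_def)
  show "continuous_on {a..b} (bracket a b \<alpha> \<beta> \<gamma> y)"
    unfolding bracket_def[abs_def] by (intro continuous_on_Pair continuous_on_id y v)
qed

lemma continuous_on_bracket_compose: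
  assumes "y \<in> Caputo_space a b \<alpha> \<beta> \<gamma>" and "continuous_on ({a..b} \<times> UNIV) K"
  shows "continuous_on {a..b} (\<lambda>x. K (bracket a b \<alpha> \<beta> \<gamma> y x))"
  by (rule continuous_on_compose2[OF assms(2) Caputo_space_continuous_on(3)[OF assms(1)]])
    (auto simp: bracket_def)

lemma LINT_eq_integral_continuous:
  fixes f :: "real \<Rightarrow> real"
  assumes "continuous_on {a..b} f"
  shows "(LINT x:{a..b}|lebesgue. f x) = integral {a..b} f"
  using assms by (intro set_lebesgue_integral_eq_integral absolutely_integrable_continuous_real)

section \<open>Minimality from convexity and the multipliers\<close>

theorem theorem4p14:
  fixes a b :: real
    and \<alpha> \<beta> \<gamma> :: "real ^ 'n"
    and r :: nat
    and L :: "real \<times> (real ^ 'n) \<times> (real ^ 'n) \<Rightarrow> real"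
    and G :: "nat \<Rightarrow> real \<times> (real ^ 'n) \<times> (real ^ 'n) \<Rightarrow> real"
    and F :: "real \<times> (real ^ 'n) \<times> (real ^ 'n) \<Rightarrow> real"
    and ya yb :: "real ^ 'n"
    and l lam :: "nat \<Rightarrow> real"
    and y0 :: "real \<Rightarrow> real ^ 'n"
  assumes "a < b"
    and "\<And>i. 0 < \<alpha> $ i \<and> \<alpha> $ i < 1"
    and "\<And>i. 0 < \<beta> $ i \<and> \<beta> $ i < 1"
    and "\<And>i. 0 \<le> \<gamma> $ i \<and> \<gamma> $ i \<le> 1"
    and "C1_on ({a..b} \<times> UNIV) L"
    and "\<And>j. j \<in> {1..r} \<Longrightarrow> C1_on ({a..b} \<times> UNIV) (G j)"
    and F_def: "F = (\<lambda>p. L p - (\<Sum>j=1..r. lam j * G j p))"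
    and "jointly_convex a b F"
    and "y0 \<in> Caputo_space a b \<alpha> \<beta> \<gamma>"
    and "y0 a = ya" and "y0 b = yb"
    and "\<And>j. j \<in> {1..r} \<Longrightarrow>
          (LINT x:{a..b}|lebesgue. G j (bracket a b \<alpha> \<beta> \<gamma> y0 x)) = l j"
    and euler_lagrange: "\<And>i x. x \<in> {a..b} \<Longrightarrow>
          combined_RL_exists a b (\<beta> $ i) (\<alpha> $ i) (1 - \<gamma> $ i)
            (\<lambda>t. partial_v i F (bracket a b \<alpha> \<beta> \<gamma> y0 t)) x \<and>
          partial_y i F (bracket a b \<alpha> \<beta> \<gamma> y0 x)
            + combined_RL a b (\<beta> $ i) (\<alpha> $ i) (1 - \<gamma> $ i)
                (\<lambda>t. partial_v i F (bracket a b \<alpha> \<beta> \<gamma> y0 t)) x = 0"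
  shows "\<forall>y \<in> Caputo_space a b \<alpha> \<beta> \<gamma>.
           y a = ya \<and> y b = yb \<and>
           (\<forall>j\<in>{1..r}. (LINT x:{a..b}|lebesgue. G j (bracket a b \<alpha> \<beta> \<gamma> y x)) = l j) \<longrightarrow>
           (LINT x:{a..b}|lebesgue. L (bracket a b \<alpha> \<beta> \<gamma> y0 x))
             \<le> (LINT x:{a..b}|lebesgue. L (bracket a b \<alpha> \<beta> \<gamma> y x))"
proof (intro ballI impI, elim conjE)
  let ?S = "{a..b} \<times> (UNIV :: ((real ^ 'n) \<times> (real ^ 'n)) set)"
  let ?br = "bracket a b \<alpha> \<beta> \<gamma>"
  let ?D = "vec_Caputo a b \<alpha> \<beta> \<gamma>"
  fix y assume y: "y \<in> Caputo_space a b \<alpha> \<beta> \<gamma>" and bc: "y a = ya" "y b = yb"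
    and G_y: "\<forall>j\<in>{1..r}. (LINT x:{a..b}|lebesgue. G j (?br y x)) = l j"
  note y0 = \<open>y0 \<in> Caputo_space a b \<alpha> \<beta> \<gamma>\<close>
  define P where "P i x = partial_y i F (?br y0 x)" for i x
  define Q where "Q i x = partial_v i F (?br y0 x)" for i x
  have F: "C1_on ?S F"
    and convex: "\<And>x y v y0 v0. x \<in> {a..b} \<Longrightarrow>
        (\<Sum>i\<in>UNIV. partial_y i F (x, y, v) * y0 $ i) + (\<Sum>i\<in>UNIV. partial_v i F (x, y, v) * v0 $ i)
        \<le> F (x, y + y0, v + v0) - F (x, y, v)"
    using \<open>jointly_convex a b F\<close> unfolding jointly_convex_def by auto
  have P: "continuous_on {a..b} (P i)" and Q: "continuous_on {a..b} (Q i)" for i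
    using continuous_on_bracket_compose[OF y0] continuous_on_partial[OF F]
    by (auto simp: P_def[abs_def] Q_def[abs_def])
  have comp: "continuous_on {a..b} (\<lambda>x. z x $ i)" "continuous_on {a..b} (\<lambda>x. ?D z x $ i)"
    if "z \<in> Caputo_space a b \<alpha> \<beta> \<gamma>" for z i
    using Caputo_space_continuous_on(1,2)[OF that] by (simp_all add: continuous_on_component)
  have integrable: "k integrable_on {a..b}" if "continuous_on {a..b} k" for k :: "real \<Rightarrow> real"
    using that by (rule integrable_continuous_real)

  define H where "H i x = \<gamma> $ i * RL_int_right b (1 - \<alpha> $ i) (Q i) x
      - (1 - \<gamma> $ i) * RL_int_left a (1 - \<beta> $ i) (Q i) x" for i x
  \<comment> \<open>\<open>P\<close>, \<open>Q\<close> and \<open>H\<close> depend on y0 alone, so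
    one identity serves both z = y and z = y0, with the same boundary factors \<open>H i a\<close>
    and \<open>H i b\<close>.\<close>
  have parts: "integral {a..b} (\<lambda>x. Q i x * ?D z x $ i) =
      z b $ i * H i b - z a $ i * H i a - integral {a..b} (\<lambda>x. z x $ i * P i x)"
    if z: "z \<in> Caputo_space a b \<alpha> \<beta> \<gamma>" for z i
  proof -
    have D: "?D z x $ i = combined_Caputo a b (\<alpha> $ i) (\<beta> $ i) (\<gamma> $ i) (\<lambda>t. z t $ i) x" for x
      by (simp add: vec_Caputo_def)
    have "(LINT x:{a..b}|lebesgue. Q i x * ?D z x $ i) =
        z b $ i * H i b - z a $ i * H i a - (LINT x:{a..b}|lebesgue. z x $ i * P i x)"
      unfolding D H_def
    proof (rule combined_Caputo_integration_by_parts[OF \<open>a < b\<close>])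
      show "0 < \<alpha> $ i" "\<alpha> $ i < 1" "0 < \<beta> $ i" "\<beta> $ i < 1" using assms(2,3) by auto
      show "AC_on a b (\<lambda>t. z t $ i)"
        "\<And>x. x \<in> {a..b} \<Longrightarrow> combined_Caputo_exists a b (\<alpha> $ i) (\<beta> $ i) (\<gamma> $ i) (\<lambda>t. z t $ i) x"
        using z by (auto simp: Caputo_space_def)
      show "combined_RL_exists a b (\<beta> $ i) (\<alpha> $ i) (1 - \<gamma> $ i) (Q i) x"
        "P i x + combined_RL a b (\<beta> $ i) (\<alpha> $ i) (1 - \<gamma> $ i) (Q i) x = 0" if "x \<in> {a..b}" for x
        using euler_lagrange[OF that, of i] by (simp_all add: P_def Q_def[abs_def])
    qed (rule P Q)+
    then show ?thesis
      using P Q comp[OF z] by (simp add: LINT_eq_integral_continuous continuous_on_mult)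
  qed
  \<comment> \<open>The first variation of F at y0 in the direction y - y0, which is the lower bound
    supplied by convexity.\<close>
  let ?R = "\<lambda>x. (\<Sum>i\<in>UNIV. P i x * (y x $ i - y0 x $ i)) + (\<Sum>i\<in>UNIV. Q i x * (?D y x $ i - ?D y0 x $ i))"
  have zero: "integral {a..b} (\<lambda>x. P i x * (y x $ i - y0 x $ i) + Q i x * (?D y x $ i - ?D y0 x $ i)) = 0" for i
  proof -
    have "integral {a..b} (\<lambda>x. P i x * (y x $ i - y0 x $ i) + Q i x * (?D y x $ i - ?D y0 x $ i)) =
        integral {a..b} (\<lambda>x. (y x $ i * P i x - y0 x $ i * P i x) + (Q i x * ?D y x $ i - Q i x * ?D y0 x $ i))"
      by (simp add: algebra_simps)
    also have "\<dots> = integral {a..b} (\<lambda>x. y x $ i * P i x) - integral {a..b} (\<lambda>x. y0 x $ i * P i x)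
        + (integral {a..b} (\<lambda>x. Q i x * ?D y x $ i) - integral {a..b} (\<lambda>x. Q i x * ?D y0 x $ i))"
      using P Q comp[OF y] comp[OF y0]
      by (simp add: Henstock_Kurzweil_Integration.integral_add Henstock_Kurzweil_Integration.integral_diff
          integrable continuous_on_mult continuous_on_diff)
    also have "\<dots> = 0" unfolding parts[OF y] parts[OF y0] using bc assms(10,11) by simp
    finally show ?thesis .
  qed
  have R: "continuous_on {a..b} ?R"
    by (intro continuous_intros P Q Caputo_space_continuous_on(1,2)[OF y] Caputo_space_continuous_on(1,2)[OF y0])
  have R0: "integral {a..b} ?R = 0"
  proof -
    have "integral {a..b} ?R =
        integral {a..b} (\<lambda>x. \<Sum>i\<in>UNIV. P i x * (y x $ i - y0 x $ i) + Q i x * (?D y x $ i - ?D y0 x $ i))"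
      by (simp add: sum.distrib)
    also have "\<dots> = 0"
      by (subst Henstock_Kurzweil_Integration.integral_sum)
        (use P Q Caputo_space_continuous_on(1,2)[OF y] Caputo_space_continuous_on(1,2)[OF y0] in \<open>auto simp: zero intro!: integrable continuous_intros\<close>)
    finally show ?thesis .
  qed
  have cont: "continuous_on {a..b} (\<lambda>x. L (?br z x))" "continuous_on {a..b} (\<lambda>x. F (?br z x))"
    "j \<in> {1..r} \<Longrightarrow> continuous_on {a..b} (\<lambda>x. G j (?br z x))"
    if "z \<in> Caputo_space a b \<alpha> \<beta> \<gamma>" for z j
    by (intro continuous_on_bracket_compose[OF that] C1_on_imp_continuous_on assms(5,6) F; assumption)+
  have "?R x \<le> F (?br y x) - F (?br y0 x)" if "x \<in> {a..b}" for x
    using convex[OF that, of "y0 x" "?D y0 x" "y x - y0 x" "?D y x - ?D y0 x"]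
    by (simp add: bracket_def P_def Q_def)
  then have "integral {a..b} ?R \<le> integral {a..b} (\<lambda>x. F (?br y x) - F (?br y0 x))"
    using R cont(2)[OF y] cont(2)[OF y0] by (intro integral_le integrable continuous_on_diff)
  then have "integral {a..b} (\<lambda>x. F (?br y0 x)) \<le> integral {a..b} (\<lambda>x. F (?br y x))"
    using R0 cont(2)[OF y] cont(2)[OF y0] by (simp add: Henstock_Kurzweil_Integration.integral_diff integrable)
  \<comment> \<open>The constraints give the multiplier part of the integral of F the same value for
    all admissible functions, so comparing F amounts to comparing L, whatever the signs of the
    multipliers.\<close>
  moreover have "integral {a..b} (\<lambda>x. F (?br z x)) = (LINT x:{a..b}|lebesgue. L (?br z x)) - (\<Sum>j=1..r. lam j * l j)"
    if z: "z \<in> Caputo_space a b \<alpha> \<beta> \<gamma>" and G: "\<And>j. j \<in> {1..r} \<Longrightarrow> (LINT x:{a..b}|lebesgue. G j (?br z x)) = l j" for z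
  proof -
    have "integral {a..b} (\<lambda>x. F (?br z x)) = integral {a..b} (\<lambda>x. L (?br z x))
        - integral {a..b} (\<lambda>x. \<Sum>j=1..r. lam j * G j (?br z x))"
      unfolding F_def
      by (intro Henstock_Kurzweil_Integration.integral_diff integrable continuous_on_sum continuous_on_mult_left cont[OF z])
    also have "integral {a..b} (\<lambda>x. \<Sum>j=1..r. lam j * G j (?br z x)) = (\<Sum>j=1..r. lam j * integral {a..b} (\<lambda>x. G j (?br z x)))"
      by (subst Henstock_Kurzweil_Integration.integral_sum)
        (use cont(3)[OF z] in \<open>auto intro!: integrable continuous_on_mult_left\<close>)
    also have "\<dots> = (\<Sum>j=1..r. lam j * l j)"
      using G cont(3)[OF z] by (intro sum.cong refl) (simp add: LINT_eq_integral_continuous)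
    finally show ?thesis using cont(1)[OF z] by (simp add: LINT_eq_integral_continuous)
  qed
  ultimately show "(LINT x:{a..b}|lebesgue. L (?br y0 x)) \<le> (LINT x:{a..b}|lebesgue. L (?br y x))"
    using y y0 G_y assms(12) by force
qed

end
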